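(* Let $\mathbf k$ be a field of characteristic $0$, $\lambda\in\mathbf k$, and let $(L,M,\iota_M,A,\iota_A,P,\Delta)$ be a generalised V-datum over $\mathbf k$. (1) The graded vector space $sL\oplus A$ is an $L_\infty[1]$-algebra with operations $$l_1(sf)=(-s[\Delta,f],P(f)),\quad l_1(\xi)=P[\Delta,\iota_A(\xi)],\quad l_2(sf,sg)=(-1)^{|f|}\lambda\, s[f,g],$$ $$l_i(sf,\xi_1,\dots,\xi_{i-1})=\lambda^{i-1}P[\cdots[f,\iota_A(\xi_1)],\cdots,\iota_A(\xi_{i-1})]\quad(i\ge2),$$ $$l_i(\xi_1,\dots,\xi_i)=\lambda^{i-1}P[\cdots[\Delta,\iota_A(\xi_1)],\cdots,\iota_A(\xi_i)]\quad(i\ge2),$$ for homogeneous $f,g\in L$, $\xi,\xi_1,\dots,\xi_i\in A$, all other components vanishing (apart from those determined by graded symmetry from the components $l_1(sf)$, $l_1(\xi)$, $l_2(sf,sg)$, $l_i(sf,\xi_1,\dots,\xi_{i-1})$ and $l_i(\xi_1,\dots,\xi_i)$ listed in this part (1)). (2) The graded vector space $sM\oplus A$ is an $L_\infty[1]$-algebra with operations $$l_1(sf)=(-s\,\iota_M^{-1}[\Delta,\iota_M(f)],P\iota_M(f)),\quad l_1(\xi)=P[\Delta,\iota_A(\xi)],\quad l_2(sf,sg)=(-1)^{|f|}\lambda\, s[f,g]_M,$$ $$l_i(sf,\xi_1,\dots,\xi_{i-1})=\lambda^{i-1}P[\cdots[\iota_M(f),\iota_A(\xi_1)],\cdots,\iota_A(\xi_{i-1})]\quad(i\ge2),$$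 $$l_i(\xi_1,\dots,\xi_i)=\lambda^{i-1}P[\cdots[\Delta,\iota_A(\xi_1)],\cdots,\iota_A(\xi_i)]\quad(i\ge2),$$ for homogeneous $f,g\in M$, $\xi,\xi_1,\dots,\xi_i\in A$, all other components vanishing (apart from those determined by graded symmetry). (3) There is an injective $L_\infty[1]$-algebra homomorphism $\iota:sM\oplus A\to sL\oplus A$ induced by $\iota_M$, namely $(sf,\xi)\mapsto(s\,\iota_M(f),\xi)$.
   Context: All graded spaces are $\mathbb Z$-graded with cohomological grading; $(sV)^n=V^{n+1}$, so $|sv|=|v|-1$. Linear maps $\iota_M,\iota_A,P$ are of degree $0$. A generalised V-datum $(L,M,\iota_M,A,\iota_A,P,\Delta)$ consists of: a graded Lie algebra $(L,[-,-])$; a graded Lie algebra $(M,[-,-]_M)$ with an injective homomorphism of graded Lie algebras $\iota_M:M\to L$; an abelian graded Lie algebra $A$ with an injective homomorphism of graded Lie algebras $\iota_A:A\to L$; a linear map $P:L\to A$ with $P\circ\iota_A=\mathrm{Id}_A$ and $\mathrm{Ker}(P)$ a graded Lie subalgebra of $L$; an element $\Delta\in\mathrm{Ker}(P)^1$ with $[\Delta,\Delta]=0$ and $[\Delta,\iota_M(M)]\subset\iota_M(M)$. An $L_\infty[1]$-algebra is a graded vector space $\mathfrak L$ with degree $1$ linear maps $l_n:\mathfrak L^{\otimes n}\to\mathfrak L$, $n\ge1$, such that $l_n(x_{\sigma(1)},\dots,x_{\sigma(n)})=\varepsilon(\sigma)l_n(x_1,\dots,x_n)$ for $\sigma\in S_n$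 ($\varepsilon(\sigma)$ the Koszul sign of the graded symmetric algebra) and $\sum_{i=1}^n\sum_{\sigma\in\mathrm{Sh}(i,n-i)}\varepsilon(\sigma)l_{n-i+1}(l_i(x_{\sigma(1)},\dots,x_{\sigma(i)}),x_{\sigma(i+1)},\dots,x_{\sigma(n)})=0$ for all $n\ge1$, where $\mathrm{Sh}(i,n-i)$ is the set of $(i,n-i)$-shuffles. The homomorphism in (3) is strict: a degree $0$ linear map commuting with all $l_n$. *)

theory Defs
  imports "HOL-Analysis.Product_Vector" "HOL-Combinatorics.Permutations"
begin

(* A graded vector space is a vector space, the type 'v with scalar multiplication scale,
   that is the internal direct sum of the subspaces G n. *)
locale graded_vector_space = vector_space scale
  for scale :: "'k::field \<Rightarrow> 'v::ab_group_add \<Rightarrow> 'v" +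
  fixes G :: "int \<Rightarrow> 'v set"
  assumes subspace_component: "module.subspace scale (G n)"
    and direct_sum: "\<exists>!x. (\<forall>n. x n \<in> G n) \<and> finite {n. x n \<noteq> 0} \<and> v = (\<Sum>n | x n \<noteq> 0. x n)"

definition graded_linear ::
  "('k::field \<Rightarrow> 'v::ab_group_add \<Rightarrow> 'v) \<Rightarrow> (int \<Rightarrow> 'v set) \<Rightarrow>
   ('k \<Rightarrow> 'w::ab_group_add \<Rightarrow> 'w) \<Rightarrow> (int \<Rightarrow> 'w set) \<Rightarrow> ('v \<Rightarrow> 'w) \<Rightarrow> bool" where
  "graded_linear s G t H f \<longleftrightarrow> Vector_Spaces.linear s t f \<and> (\<forall>n. f ` G n \<subseteq> H n)"

locale graded_lie_algebra = graded_vector_space scale G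
  for scale :: "'k::field \<Rightarrow> 'v::ab_group_add \<Rightarrow> 'v" and G :: "int \<Rightarrow> 'v set" +
  fixes br :: "'v \<Rightarrow> 'v \<Rightarrow> 'v"
  assumes linear_left: "Vector_Spaces.linear scale scale (\<lambda>x. br x y)"
    and linear_right: "Vector_Spaces.linear scale scale (\<lambda>y. br x y)"
    and bracket_degree: "x \<in> G m \<Longrightarrow> y \<in> G n \<Longrightarrow> br x y \<in> G (m + n)"
    and antisymmetry: "x \<in> G m \<Longrightarrow> y \<in> G n \<Longrightarrow> br x y = - scale ((-1) powi (m * n)) (br y x)"
    and jacobi: "x \<in> G m \<Longrightarrow> y \<in> G n \<Longrightarrow> z \<in> G p \<Longrightarrow>
      br x (br y z) = br (br x y) z + scale ((-1) powi (m * n)) (br y (br x z))"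

definition graded_lie_hom ::
  "('k::field \<Rightarrow> 'v::ab_group_add \<Rightarrow> 'v) \<Rightarrow> (int \<Rightarrow> 'v set) \<Rightarrow> ('v \<Rightarrow> 'v \<Rightarrow> 'v) \<Rightarrow>
   ('k \<Rightarrow> 'w::ab_group_add \<Rightarrow> 'w) \<Rightarrow> (int \<Rightarrow> 'w set) \<Rightarrow> ('w \<Rightarrow> 'w \<Rightarrow> 'w) \<Rightarrow> ('v \<Rightarrow> 'w) \<Rightarrow> bool" where
  "graded_lie_hom s G br t H br' f \<longleftrightarrow>
     graded_linear s G t H f \<and> (\<forall>x y. f (br x y) = br' (f x) (f y))"

definition graded_lie_subalgebra ::
  "('k::field \<Rightarrow> 'v::ab_group_add \<Rightarrow> 'v) \<Rightarrow> (int \<Rightarrow> 'v set) \<Rightarrow> ('v \<Rightarrow> 'v \<Rightarrow> 'v) \<Rightarrow> 'v set \<Rightarrow> bool" where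
  "graded_lie_subalgebra s G br S \<longleftrightarrow>
     module.subspace s S \<and>
     (\<forall>v\<in>S. \<exists>x. (\<forall>n. x n \<in> S \<inter> G n) \<and> finite {n. x n \<noteq> 0} \<and> v = (\<Sum>n | x n \<noteq> 0. x n)) \<and>
     (\<forall>x\<in>S. \<forall>y\<in>S. br x y \<in> S)"

locale generalised_V_datum =
  L: graded_lie_algebra sL GL brL + M: graded_lie_algebra sM GM brM +
  A: graded_lie_algebra sA GA brA
  for sL :: "'k::field \<Rightarrow> 'l::ab_group_add \<Rightarrow> 'l" and GL :: "int \<Rightarrow> 'l set" and brL :: "'l \<Rightarrow> 'l \<Rightarrow> 'l"
    and sM :: "'k \<Rightarrow> 'm::ab_group_add \<Rightarrow> 'm" and GM :: "int \<Rightarrow> 'm set" and brM :: "'m \<Rightarrow> 'm \<Rightarrow> 'm"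
    and \<iota>M :: "'m \<Rightarrow> 'l"
    and sA :: "'k \<Rightarrow> 'a::ab_group_add \<Rightarrow> 'a" and GA :: "int \<Rightarrow> 'a set" and brA :: "'a \<Rightarrow> 'a \<Rightarrow> 'a"
    and \<iota>A :: "'a \<Rightarrow> 'l" and P :: "'l \<Rightarrow> 'a" and \<Delta> :: 'l +
  assumes iotaM_hom: "graded_lie_hom sM GM brM sL GL brL \<iota>M"
    and iotaM_inj: "inj \<iota>M"
    and A_abelian: "brA \<xi> \<eta> = 0"
    and iotaA_hom: "graded_lie_hom sA GA brA sL GL brL \<iota>A"
    and iotaA_inj: "inj \<iota>A"
    and P_linear: "graded_linear sL GL sA GA P"
    and P_iotaA: "P (\<iota>A \<xi>) = \<xi>"
    and kernel_subalgebra: "graded_lie_subalgebra sL GL brL {f. P f = 0}"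
    and Delta_degree: "\<Delta> \<in> GL 1"
    and Delta_kernel: "P \<Delta> = 0"
    and Delta_square: "brL \<Delta> \<Delta> = 0"
    and Delta_iotaM: "brL \<Delta> ` range \<iota>M \<subseteq> range \<iota>M"

(* The Koszul sign of x_0 ... x_(n-1) = sign . x_(sigma 0) ... x_(sigma (n-1)) in the graded
   symmetric algebra, where ds lists the degrees of the x_i: one factor per inversion. *)
definition koszul_sign :: "int list \<Rightarrow> (nat \<Rightarrow> nat) \<Rightarrow> 'k::field" where
  "koszul_sign ds \<sigma> =
     (\<Prod>(i, j) \<in> {(i, j). i < j \<and> j < length ds \<and> \<sigma> j < \<sigma> i}. (-1) powi (ds ! \<sigma> i * ds ! \<sigma> j))"

definition Sh :: "nat \<Rightarrow> nat \<Rightarrow> (nat \<Rightarrow> nat) set" where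
  "Sh p q = {\<sigma>. \<sigma> permutes {..<p + q} \<and> strict_mono_on {..<p} \<sigma> \<and> strict_mono_on {p..<p + q} \<sigma>}"

(* The degree 1 linear map l_n on the n-th tensor power is given as the multilinear map that l
   induces on lists of length n.  There is no l_0, so the value at the empty list is normalised
   to 0.  In degree and symmetry, list_all2 (\<lambda>x d. x \<in> G d) xs ds says that the entries of xs are
   homogeneous of the degrees ds. *)
locale L_infinity_1_algebra = graded_vector_space scale G
  for scale :: "'k::field \<Rightarrow> 'v::ab_group_add \<Rightarrow> 'v" and G :: "int \<Rightarrow> 'v set" +
  fixes l :: "'v list \<Rightarrow> 'v"
  assumes l_Nil: "l [] = 0"
    and multilinear: "Vector_Spaces.linear scale scale (\<lambda>x. l (xs @ x # ys))"
    and degree: "xs \<noteq> [] \<Longrightarrow> list_all2 (\<lambda>x d. x \<in> G d) xs ds \<Longrightarrow> l xs \<in> G (sum_list ds + 1)"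
    and symmetry: "list_all2 (\<lambda>x d. x \<in> G d) xs ds \<Longrightarrow> \<sigma> permutes {..<length xs} \<Longrightarrow>
      l (permute_list \<sigma> xs) = scale (koszul_sign ds \<sigma>) (l xs)"
    and higher_jacobi: "n \<ge> 1 \<Longrightarrow> length xs = n \<Longrightarrow> list_all2 (\<lambda>x d. x \<in> G d) xs ds \<Longrightarrow>
      (\<Sum>i = 1..n. \<Sum>\<sigma>\<in>Sh i (n - i). scale (koszul_sign ds \<sigma>)
         (l (l (take i (permute_list \<sigma> xs)) # drop i (permute_list \<sigma> xs)))) = 0"

definition strict_L_infinity_1_hom ::
  "('k::field \<Rightarrow> 'v::ab_group_add \<Rightarrow> 'v) \<Rightarrow> (int \<Rightarrow> 'v set) \<Rightarrow> ('v list \<Rightarrow> 'v) \<Rightarrow>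
   ('k \<Rightarrow> 'w::ab_group_add \<Rightarrow> 'w) \<Rightarrow> (int \<Rightarrow> 'w set) \<Rightarrow> ('w list \<Rightarrow> 'w) \<Rightarrow> ('v \<Rightarrow> 'w) \<Rightarrow> bool" where
  "strict_L_infinity_1_hom s G l t H l' f \<longleftrightarrow>
     graded_linear s G t H f \<and> (\<forall>xs. xs \<noteq> [] \<longrightarrow> f (l xs) = l' (map f xs))"

(* The suspension sV has the same underlying vector space as V, and sf is f itself; so
   the pair (f, \<xi>) stands for (sf, \<xi>). *)
definition suspension :: "(int \<Rightarrow> 'v set) \<Rightarrow> int \<Rightarrow> 'v set" where
  "suspension G n = G (n + 1)"

definition sum_grading :: "(int \<Rightarrow> 'v set) \<Rightarrow> (int \<Rightarrow> 'w set) \<Rightarrow> int \<Rightarrow> ('v \<times> 'w) set" where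
  "sum_grading G H n = G n \<times> H n"

(* The prescribed components of the operations on sL + A.  The degree in the sign of l_2(sf,sg)
   is that of f in L.  The last clause states that an operation with at least three arguments
   vanishes if two of them lie in sL; together with the others and graded symmetry it covers
   all components. *)
definition operations_sL_A ::
  "('k::field \<Rightarrow> 'l::ab_group_add \<Rightarrow> 'l) \<Rightarrow> (int \<Rightarrow> 'l set) \<Rightarrow> ('l \<Rightarrow> 'l \<Rightarrow> 'l) \<Rightarrow>
   ('k \<Rightarrow> 'a::ab_group_add \<Rightarrow> 'a) \<Rightarrow> ('a \<Rightarrow> 'l) \<Rightarrow> ('l \<Rightarrow> 'a) \<Rightarrow> 'l \<Rightarrow> 'k \<Rightarrow>
   (('l \<times> 'a) list \<Rightarrow> 'l \<times> 'a) \<Rightarrow> bool" where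
  "operations_sL_A sL GL brL sA \<iota>A P \<Delta> lam l \<longleftrightarrow>
     (\<forall>f. l [(f, 0)] = (- brL \<Delta> f, P f)) \<and>
     (\<forall>\<xi>. l [(0, \<xi>)] = (0, P (brL \<Delta> (\<iota>A \<xi>)))) \<and>
     (\<forall>d f g. f \<in> GL d \<longrightarrow> l [(f, 0), (g, 0)] = (sL ((-1) powi d * lam) (brL f g), 0)) \<and>
     (\<forall>f \<xi>s. length \<xi>s \<ge> 1 \<longrightarrow>
        l ((f, 0) # map (\<lambda>\<xi>. (0, \<xi>)) \<xi>s) =
          (0, sA (lam ^ length \<xi>s) (P (foldl (\<lambda>x \<xi>. brL x (\<iota>A \<xi>)) f \<xi>s)))) \<and>
     (\<forall>\<xi>s. length \<xi>s \<ge> 2 \<longrightarrow>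
        l (map (\<lambda>\<xi>. (0, \<xi>)) \<xi>s) =
          (0, sA (lam ^ (length \<xi>s - 1)) (P (foldl (\<lambda>x \<xi>. brL x (\<iota>A \<xi>)) \<Delta> \<xi>s)))) \<and>
     (\<forall>xs i j. length xs \<ge> 3 \<and> i < j \<and> j < length xs \<and> snd (xs ! i) = 0 \<and> snd (xs ! j) = 0 \<longrightarrow>
        l xs = 0)"

definition operations_sM_A ::
  "('l::ab_group_add \<Rightarrow> 'l \<Rightarrow> 'l) \<Rightarrow>
   ('k::field \<Rightarrow> 'm::ab_group_add \<Rightarrow> 'm) \<Rightarrow> (int \<Rightarrow> 'm set) \<Rightarrow> ('m \<Rightarrow> 'm \<Rightarrow> 'm) \<Rightarrow> ('m \<Rightarrow> 'l) \<Rightarrow>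
   ('k \<Rightarrow> 'a::ab_group_add \<Rightarrow> 'a) \<Rightarrow> ('a \<Rightarrow> 'l) \<Rightarrow> ('l \<Rightarrow> 'a) \<Rightarrow> 'l \<Rightarrow> 'k \<Rightarrow>
   (('m \<times> 'a) list \<Rightarrow> 'm \<times> 'a) \<Rightarrow> bool" where
  "operations_sM_A brL sM GM brM \<iota>M sA \<iota>A P \<Delta> lam l \<longleftrightarrow>
     (\<forall>f. l [(f, 0)] = (- inv \<iota>M (brL \<Delta> (\<iota>M f)), P (\<iota>M f))) \<and>
     (\<forall>\<xi>. l [(0, \<xi>)] = (0, P (brL \<Delta> (\<iota>A \<xi>)))) \<and>
     (\<forall>d f g. f \<in> GM d \<longrightarrow> l [(f, 0), (g, 0)] = (sM ((-1) powi d * lam) (brM f g), 0)) \<and>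
     (\<forall>f \<xi>s. length \<xi>s \<ge> 1 \<longrightarrow>
        l ((f, 0) # map (\<lambda>\<xi>. (0, \<xi>)) \<xi>s) =
          (0, sA (lam ^ length \<xi>s) (P (foldl (\<lambda>x \<xi>. brL x (\<iota>A \<xi>)) (\<iota>M f) \<xi>s)))) \<and>
     (\<forall>\<xi>s. length \<xi>s \<ge> 2 \<longrightarrow>
        l (map (\<lambda>\<xi>. (0, \<xi>)) \<xi>s) =
          (0, sA (lam ^ (length \<xi>s - 1)) (P (foldl (\<lambda>x \<xi>. brL x (\<iota>A \<xi>)) \<Delta> \<xi>s)))) \<and>
     (\<forall>xs i j. length xs \<ge> 3 \<and> i < j \<and> j < length xs \<and> snd (xs ! i) = 0 \<and> snd (xs ! j) = 0 \<longrightarrow>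
        l xs = 0)"

end

theory Submission
  imports Defs
begin

text \<open>Rescaling \<open>l\<^sub>n\<close> by \<open>\<lambda>\<^bsup>n-1\<^esup>\<close> preserves \<open>L\<^sub>\<infinity>[1]\<close>-algebras, and the operations containing
  \<open>\<Delta>\<close> arise from those without it by twisting with the Maurer-Cartan element \<open>s \<Delta>\<close>, so the case
  \<open>\<lambda> = 1\<close>, \<open>\<Delta> = 0\<close> is the essential one. There the \<open>L\<close>-component of the Jacobi identities is the
  Jacobi identity of \<open>L\<close>. For the \<open>A\<close>-component, let \<open>w(x\<^sub>1, \<dots>, x\<^sub>n) \<in> L\<close> be the multilinear
  coefficient of \<open>exp(ad \<xi>) f\<close>, so that \<open>l\<^sub>n = P w\<close>. As \<open>\<iota>\<^sub>A(A)\<close> is abelian and \<open>Ker P\<close> is a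
  subalgebra, \<open>P[a, b] = P[P a, b] + P[a, P b]\<close>; hence twice the sum of the terms \<open>l(l(\<dots>), \<dots>)\<close>
  with both operations landing in \<open>A\<close> is \<open>P\<close> of the coefficient of
  \<open>[exp(ad \<xi>) f, exp(ad \<xi>) f] = exp(ad \<xi>) [f, f]\<close>, which cancels the terms
  \<open>l(l\<^sub>2(s f, s f), \<dots>)\<close>. The operations on \<open>s M \<oplus> A\<close> are restrictions.\<close>

text \<open>The obstacle is the sign bookkeeping, and three choices of form keep it in check. Sums
  over shuffles are replaced by a recursion over the argument list, so that identities between
  coefficients of exponentials become inductions in which the head joins either the inner or the
  outer operation. An argument is always a whole pair \<open>(f, \<xi>)\<close>, so that one formula
  covers all mixed components, however many entries come from \<open>sL\<close>. Entries carry their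
  degrees only in the identities; the operations themselves use a parity involution for signs and so
  are multilinear on all lists.

  Twisting needs no infinite series: an operation with two entries \<open>\<Delta>\<close> vanishes,
  so a single insertion survives. Division by 2 happens twice, in the doubled sum of the overview
  and when two copies of \<open>\<Delta>\<close> are put into a Jacobi identity. Uniqueness is a
  separate argument: the listed components, symmetry and multilinearity determine every
  value.\<close>

section \<open>Signs\<close>

text \<open>Signs act on an arbitrary abelian group because unshuffle sums take values in groups
  with no scalar field in sight. Every additive map then commutes with signs, and sign identities
  are settled by parities of integers.\<close>

definition sg :: "int \<Rightarrow> 'a::ab_group_add \<Rightarrow> 'a" where
  "sg n v = (if even n then v else - v)"

lemma sg_0 [simp]: "sg 0 v = v"
  by (simp add: sg_def)

lemma sg_zero [simp]: "sg n 0 = 0"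
  by (simp add: sg_def)

lemma sg_sg [simp]: "sg m (sg n v) = sg (m + n) v"
  by (simp add: sg_def)

lemma sg_add: "sg n (v + w) = sg n v + sg n w"
  by (simp add: sg_def)

lemma sg_diff: "sg n (v - w) = sg n v - sg n w"
  by (simp add: sg_def)

lemma sg_cong: "even (m - n) \<Longrightarrow> sg m v = sg n v"
  by (auto simp: sg_def)

lemma sg_hom: "additive h \<Longrightarrow> h (sg n v) = sg n (h v)"
  by (simp add: sg_def additive.minus)

lemma fst_sg [simp]: "fst (sg n v) = sg n (fst v)"
  and snd_sg [simp]: "snd (sg n v) = sg n (snd v)"
  by (simp_all add: sg_def)

lemma powi_minus_1: "(- 1 :: 'k::field) powi n = (if even n then 1 else - 1)"
  by (cases n) (auto simp: power_int_def nat_minus_as_int even_nat_iff)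

lemma (in vector_space) scale_powi_minus_1: "scale ((- 1) powi n) v = sg n v"
  by (simp add: powi_minus_1 sg_def)

section \<open>Sums over unshuffles\<close>

abbreviation deg :: "('p \<times> int) list \<Rightarrow> int" where
  "deg ps \<equiv> sum_list (map snd ps)"

text \<open>The entries of \<open>ps\<close> are elements paired with their degrees. The sum ranges over all splittings of
  \<open>ps\<close> into complementary sublists \<open>u\<close> and \<open>v\<close>, with the Koszul sign of moving \<open>u\<close> in front of \<open>v\<close>;
  unlike the sum over shuffles it allows \<open>u = []\<close>.\<close>

primrec unshuffle_sum ::
  "('p \<times> int) list \<Rightarrow> (('p \<times> int) list \<Rightarrow> ('p \<times> int) list \<Rightarrow> 'w::ab_group_add) \<Rightarrow> 'w" where
  "unshuffle_sum [] F = F [] []"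
| "unshuffle_sum (p # ps) F =
     unshuffle_sum ps (\<lambda>u v. F (p # u) v) + unshuffle_sum ps (\<lambda>u v. sg (snd p * deg u) (F u (p # v)))"

text \<open>The multiset of entries is what every splitting preserves and what the induction can
  carry; lengths, entries and total degree are read off from it in
  \<open>unshuffle_sum_cong\<close>.\<close>

lemma unshuffle_sum_cong_mset:
  assumes "\<And>u v. mset u + mset v = mset ps \<Longrightarrow> F u v = F' u v"
  shows "unshuffle_sum ps F = unshuffle_sum ps F'"
  using assms
proof (induction ps arbitrary: F F')
  case (Cons p ps)
  have "unshuffle_sum ps (\<lambda>u v. F (p # u) v) = unshuffle_sum ps (\<lambda>u v. F' (p # u) v)"
    by (rule Cons.IH) (rule Cons.prems, simp)
  moreover have "unshuffle_sum ps (\<lambda>u v. sg (snd p * deg u) (F u (p # v))) =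
      unshuffle_sum ps (\<lambda>u v. sg (snd p * deg u) (F' u (p # v)))"
    by (rule Cons.IH, rule arg_cong[where f = "sg _"], rule Cons.prems) simp
  ultimately show ?case by simp
qed simp

lemma unshuffle_sum_cong:
  assumes "\<And>u v. length u + length v = length ps \<Longrightarrow> set u \<union> set v = set ps \<Longrightarrow>
    deg u + deg v = deg ps \<Longrightarrow> F u v = F' u v"
  shows "unshuffle_sum ps F = unshuffle_sum ps F'"
proof (rule unshuffle_sum_cong_mset)
  fix u v assume *: "mset u + mset v = mset ps"
  have "length u + length v = length ps"
    using arg_cong[OF *, of size] by simp
  moreover have "set u \<union> set v = set ps"
    using arg_cong[OF *, of set_mset] by simp
  moreover have "deg u + deg v = deg ps"
    using arg_cong[OF *, of "\<lambda>M. sum_mset (image_mset snd M)"] by (simp add: sum_mset_sum_list flip: mset_map)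
  ultimately show "F u v = F' u v" by (rule assms)
qed

lemma unshuffle_sum_0 [simp]: "unshuffle_sum ps (\<lambda>u v. 0) = 0"
  by (induction ps) simp_all

lemma unshuffle_sum_add: "unshuffle_sum ps (\<lambda>u v. F u v + F' u v) = unshuffle_sum ps F + unshuffle_sum ps F'"
  by (induction ps arbitrary: F F') (simp_all add: sg_add algebra_simps)

lemma unshuffle_sum_hom:
  assumes "additive h"
  shows "unshuffle_sum ps (\<lambda>u v. h (F u v)) = h (unshuffle_sum ps F)"
  by (induction ps arbitrary: F) (simp_all add: additive.add[OF assms] flip: sg_hom[OF assms])

lemma additive_sg: "additive (sg n)"
  by (standard) (simp add: sg_add)

lemma unshuffle_sum_sg: "unshuffle_sum ps (\<lambda>u v. sg n (F u v)) = sg n (unshuffle_sum ps F)"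
  by (rule unshuffle_sum_hom[OF additive_sg])

lemma additive_uminus: "additive (uminus :: 'a::ab_group_add \<Rightarrow> 'a)"
  by standard simp

lemma unshuffle_sum_minus: "unshuffle_sum ps (\<lambda>u v. - F u v) = - unshuffle_sum ps F"
  by (rule unshuffle_sum_hom[OF additive_uminus])

lemma unshuffle_sum_map:
  assumes "\<And>p. snd (h p) = snd p"
  shows "unshuffle_sum (map h ps) F = unshuffle_sum ps (\<lambda>u v. F (map h u) (map h v))"
  by (induction ps arbitrary: F) (simp_all add: assms comp_def)

text \<open>Exchanging the two halves is an involution on splittings, and the sign is that of moving
  one block past the other. In the induction the two summands of the recursion trade places.\<close>

lemma unshuffle_sum_swap:
  "unshuffle_sum ps F = unshuffle_sum ps (\<lambda>u v. sg (deg u * deg v) (F v u))"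
proof (induction ps arbitrary: F)
  case (Cons p ps)
  have "unshuffle_sum ps (\<lambda>u v. F (p # u) v) =
      unshuffle_sum ps (\<lambda>u v. sg (snd p * deg u) (sg (deg u * deg (p # v)) (F (p # v) u)))"
    by (subst Cons.IH, rule unshuffle_sum_cong) (auto intro!: sg_cong simp: algebra_simps)
  moreover have "unshuffle_sum ps (\<lambda>u v. sg (snd p * deg u) (F u (p # v))) =
      unshuffle_sum ps (\<lambda>u v. sg (deg (p # u) * deg v) (F v (p # u)))"
    by (subst Cons.IH, rule unshuffle_sum_cong) (auto intro!: sg_cong simp: algebra_simps)
  ultimately show ?case
    by (simp add: add.commute)
qed simp

lemma unshuffle_sum_Nil_left:
  "unshuffle_sum ps (\<lambda>u v. if u = [] then H v else 0) = H ps"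
proof (induction ps arbitrary: H)
  case (Cons p ps)
  have "unshuffle_sum ps (\<lambda>u v. sg (snd p * deg u) (if u = [] then H (p # v) else 0)) =
      unshuffle_sum ps (\<lambda>u v. if u = [] then H (p # v) else 0)"
    by (rule unshuffle_sum_cong) simp
  then show ?case by (simp add: Cons.IH)
qed simp

section \<open>Splittings as subsets of positions, and comparison with shuffles\<close>

definition crossing :: "int list \<Rightarrow> nat set \<Rightarrow> int" where
  "crossing ds I = (\<Sum>a<length ds. \<Sum>b<length ds. if a < b \<and> a \<notin> I \<and> b \<in> I then ds ! a * ds ! b else 0)"

lemma sum_list_nths:
  "I \<subseteq> {..<length ds} \<Longrightarrow> sum_list (nths ds I) = (\<Sum>b<length ds. if b \<in> I then ds ! b else (0::int))"
proof (induction ds arbitrary: I)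
  case (Cons d ds)
  have "{j. Suc j \<in> I} \<subseteq> {..<length ds}" using Cons.prems by auto
  from Cons.IH[OF this] show ?case
    by (simp add: nths_Cons sum.lessThan_Suc_shift del: sum.lessThan_Suc cong: if_cong)
qed simp

text \<open>If the set \<open>I\<close> of positions omits 0, the head goes to \<open>v\<close> and
  every chosen entry has to cross it, which adds \<open>snd p * deg u\<close> to
  \<open>crossing\<close>. If \<open>I\<close> contains 0, the head already stands in front and adds
  no crossing.\<close>

lemma unshuffle_sum_subsets:
  "unshuffle_sum ps F =
     (\<Sum>I\<in>Pow {..<length ps}. sg (crossing (map snd ps) I) (F (nths ps I) (nths ps (- I))))"
proof (induction ps arbitrary: F)
  case Nil
  show ?case by (simp add: crossing_def)
next
  case (Cons p ps)
  let ?n = "length ps" and ?ds = "map snd ps"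
  let ?f = "\<lambda>I. sg (crossing (map snd (p # ps)) I) (F (nths (p # ps) I) (nths (p # ps) (- I)))"
  have inj: "inj_on ((`) Suc) X" for X
    by (rule inj_onI) (simp add: inj_image_eq_iff)
  have Pow: "Pow {..<length (p # ps)} = (`) Suc ` Pow {..<?n} \<union> insert 0 ` (`) Suc ` Pow {..<?n}"
    by (simp add: lessThan_Suc_eq_insert_0 Pow_insert image_Pow_surj)
  have inj0: "inj_on (insert 0) ((`) Suc ` Pow {..<?n})"
    by (rule inj_onI) (auto simp: image_iff set_eq_iff)
  have A: "?f (Suc ` I) = sg (crossing ?ds I) (sg (snd p * deg (nths ps I)) (F (nths ps I) (p # nths ps (- I))))"
    if "I \<in> Pow {..<?n}" for I
  proof -
    have I: "I \<subseteq> {..<length ?ds}" using that by simp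
    have "crossing (map snd (p # ps)) (Suc ` I) = snd p * deg (nths ps I) + crossing ?ds I"
      using sum_list_nths[OF I]
      by (simp add: crossing_def sum.lessThan_Suc_shift sum_distrib_left nths_map if_distrib
          inj_image_mem_iff[OF inj_Suc]
          del: sum.lessThan_Suc cong: if_cong)
    then show ?thesis
      by (simp add: nths_Cons inj_image_mem_iff[OF inj_Suc] add.commute Compl_eq)
  qed
  have B: "?f (insert 0 (Suc ` I)) = sg (crossing ?ds I) (F (p # nths ps I) (nths ps (- I)))" for I
  proof -
    have "crossing (map snd (p # ps)) (insert 0 (Suc ` I)) = crossing ?ds I"
      by (simp add: crossing_def sum.lessThan_Suc_shift inj_image_mem_iff[OF inj_Suc] del: sum.lessThan_Suc
          cong: if_cong)
    then show ?thesis
      by (simp add: nths_Cons inj_image_mem_iff[OF inj_Suc] Compl_eq)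
  qed
  have "(\<Sum>I\<in>Pow {..<length (p # ps)}. ?f I) =
      (\<Sum>I\<in>(`) Suc ` Pow {..<?n}. ?f I) + (\<Sum>I\<in>insert 0 ` (`) Suc ` Pow {..<?n}. ?f I)"
    unfolding Pow by (rule sum.union_disjoint) auto
  also have "(\<Sum>I\<in>(`) Suc ` Pow {..<?n}. ?f I) = (\<Sum>I\<in>Pow {..<?n}. ?f (Suc ` I))"
    by (simp add: sum.reindex[OF inj])
  also have "(\<Sum>I\<in>insert 0 ` (`) Suc ` Pow {..<?n}. ?f I) = (\<Sum>I\<in>Pow {..<?n}. ?f (insert 0 (Suc ` I)))"
    by (simp add: sum.reindex[OF inj0] sum.reindex[OF inj])
  also have "(\<Sum>I\<in>Pow {..<?n}. ?f (Suc ` I)) =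
      (\<Sum>I\<in>Pow {..<?n}. sg (crossing ?ds I) (sg (snd p * deg (nths ps I)) (F (nths ps I) (p # nths ps (- I)))))"
    by (rule sum.cong[OF refl]) (rule A)
  finally show ?case
    unfolding B by (simp add: Cons.IH del: sg_sg)
qed

lemma prod_powi_minus_1: "finite S \<Longrightarrow> (\<Prod>x\<in>S. (- 1 :: 'k::field) powi f x) = (- 1) powi (\<Sum>x\<in>S. f x)"
  by (induction S rule: finite_induct) (auto simp: powi_minus_1)

lemma crossing_altdef:
  "crossing ds I = (\<Sum>(a, b)\<in>{(a, b). a < b \<and> b < length ds \<and> a \<notin> I \<and> b \<in> I}. ds ! a * ds ! b)"
proof -
  have "crossing ds I = (\<Sum>x\<in>{..<length ds} \<times> {..<length ds}.
      if fst x < snd x \<and> fst x \<notin> I \<and> snd x \<in> I then ds ! fst x * ds ! snd x else 0)"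
    unfolding crossing_def sum.cartesian_product by (simp add: case_prod_beta)
  also have "\<dots> = (\<Sum>x\<in>{x \<in> {..<length ds} \<times> {..<length ds}. fst x < snd x \<and> fst x \<notin> I \<and> snd x \<in> I}.
      ds ! fst x * ds ! snd x)"
    by (rule sum.inter_filter[symmetric]) simp
  also have "{x \<in> {..<length ds} \<times> {..<length ds}. fst x < snd x \<and> fst x \<notin> I \<and> snd x \<in> I} =
      {(a, b). a < b \<and> b < length ds \<and> a \<notin> I \<and> b \<in> I}"
    by auto
  finally show ?thesis by (simp add: case_prod_beta)
qed

lemma Sh_strict_mono:
  assumes "\<sigma> \<in> Sh p q"
  shows "\<And>i j. i < j \<Longrightarrow> j < p \<Longrightarrow> \<sigma> i < \<sigma> j"
    and "\<And>i j. p \<le> i \<Longrightarrow> i < j \<Longrightarrow> j < p + q \<Longrightarrow> \<sigma> i < \<sigma> j"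
  using assms by (auto simp: Sh_def strict_mono_on_def)

text \<open>A shuffle increases on both blocks, so an inversion \<open>(i, j)\<close> has
  \<open>i\<close> in the first block and \<open>j\<close> in the second;
  \<open>(\<sigma> j, \<sigma> i)\<close> is then one of the pairs counted by
  \<open>crossing\<close>, and every such pair arises once.\<close>

lemma koszul_sign_shuffle:
  assumes \<sigma>: "\<sigma> \<in> Sh p q" and len: "length ds = p + q"
  shows "(koszul_sign ds \<sigma> :: 'k::field) = (- 1) powi crossing ds (\<sigma> ` {..<p})"
proof -
  have perm: "\<sigma> permutes {..<p + q}" using \<sigma> by (simp add: Sh_def)
  let ?Inv = "{(i, j). i < j \<and> j < length ds \<and> \<sigma> j < \<sigma> i}"
  let ?C = "{(a, b). a < b \<and> b < length ds \<and> a \<notin> \<sigma> ` {..<p} \<and> b \<in> \<sigma> ` {..<p}}"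
  let ?h = "\<lambda>(i, j). (\<sigma> j, \<sigma> i)"
  have \<sigma>_less: "\<sigma> i < p + q" if "i < p + q" for i
    using permutes_in_image[OF perm, of i] that by simp
  have mem: "\<sigma> i \<in> \<sigma> ` {..<p} \<longleftrightarrow> i < p" for i
    using inj_image_mem_iff[OF permutes_inj[OF perm]] by simp
  have inv: "i < p \<and> p \<le> j" if "i < j" "j < p + q" "\<sigma> j < \<sigma> i" for i j
    using that Sh_strict_mono[OF \<sigma>] by (meson leI less_imp_le_nat less_asym order.trans)
  have image: "?h ` ?Inv = ?C"
  proof (intro equalityI subsetI)
    fix x assume "x \<in> ?h ` ?Inv"
    then obtain i j where "x = (\<sigma> j, \<sigma> i)" "i < j" "j < p + q" "\<sigma> j < \<sigma> i"
      using len by auto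
    then show "x \<in> ?C"
      using inv[of i j] len \<sigma>_less by (auto simp: mem)
  next
    fix x assume "x \<in> ?C"
    then obtain a i where x: "x = (a, \<sigma> i)" "a < \<sigma> i" "\<sigma> i < p + q" "a \<notin> \<sigma> ` {..<p}" "i < p"
      using len by auto
    have "a \<in> \<sigma> ` {..<p + q}"
      using x(2,3) by (simp add: permutes_image[OF perm])
    then obtain j where j: "a = \<sigma> j" "j < p + q" by auto
    then have "p \<le> j" using x by (auto simp: mem)
    then have "(i, j) \<in> ?Inv" using x j len by auto
    then show "x \<in> ?h ` ?Inv" using x j by force
  qed
  have fin: "finite ?Inv"
    by (rule finite_subset[of _ "{..<length ds} \<times> {..<length ds}"]) auto
  have "inj_on ?h ?Inv"
    using injD[OF permutes_inj[OF perm]] by (auto intro!: inj_onI)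
  then have "(koszul_sign ds \<sigma> :: 'k) = (\<Prod>(a, b)\<in>?h ` ?Inv. (- 1) powi (ds ! a * ds ! b))"
    unfolding koszul_sign_def by (subst prod.reindex) (simp_all add: case_prod_beta comp_def mult.commute)
  also have "\<dots> = (- 1) powi crossing ds (\<sigma> ` {..<p})"
    using fin unfolding image crossing_altdef by (subst prod_powi_minus_1[symmetric])
      (auto simp: case_prod_beta simp flip: image)
  finally show ?thesis .
qed

lemma nths_conv_filter: "nths xs I = map ((!) xs) (filter (\<lambda>i. i \<in> I) [0..<length xs])"
proof (induction xs arbitrary: I)
  case (Cons x xs)
  have upt: "[0..<length (x # xs)] = 0 # map Suc [0..<length xs]"
    by (simp add: map_Suc_upt upt_conv_Cons del: upt_Suc)
  have "filter (\<lambda>i. i \<in> I) [0..<length (x # xs)] =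
      (if 0 \<in> I then [0] else []) @ map Suc (filter (\<lambda>i. Suc i \<in> I) [0..<length xs])"
    unfolding upt by (simp add: filter_map comp_def)
  then show ?case by (simp add: nths_Cons Cons.IH del: upt_Suc)
qed simp

text \<open>Both sides are sorted, without repetitions, and have the same elements. Hence a shuffle
  is determined by the image of its first block.\<close>

lemma Sh_map_upt:
  assumes \<sigma>: "\<sigma> \<in> Sh p q"
  shows "map \<sigma> [0..<p] = filter (\<lambda>i. i \<in> \<sigma> ` {..<p}) [0..<p + q]"
    and "map \<sigma> [p..<p + q] = filter (\<lambda>i. i \<notin> \<sigma> ` {..<p}) [0..<p + q]"
proof -
  have perm: "\<sigma> permutes {..<p + q}" using \<sigma> by (simp add: Sh_def)
  have mem: "\<sigma> i \<in> \<sigma> ` {..<p} \<longleftrightarrow> i < p" for i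
    using inj_image_mem_iff[OF permutes_inj[OF perm]] by simp
  have im: "\<sigma> ` {0..<p + q} = {0..<p + q}"
    using permutes_image[OF perm] by (simp add: atLeast0LessThan)
  have dist: "distinct (map \<sigma> [a..<b])" for a b
    using permutes_inj[OF perm] by (simp add: distinct_map inj_on_def)
  have "sorted (map \<sigma> [0..<p])"
    using Sh_strict_mono(1)[OF \<sigma>] by (auto simp: sorted_iff_nth_mono_less less_imp_le)
  moreover have "\<sigma> ` {0..<p} = {i \<in> {0..<p + q}. i \<in> \<sigma> ` {..<p}}"
    using im by (force simp: atLeast0LessThan)
  ultimately show "map \<sigma> [0..<p] = filter (\<lambda>i. i \<in> \<sigma> ` {..<p}) [0..<p + q]"
    by (intro sorted_distinct_set_unique) (simp_all add: dist sorted_wrt_filter)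
  have "sorted (map \<sigma> [p..<p + q])"
    using Sh_strict_mono(2)[OF \<sigma>] by (auto simp: sorted_iff_nth_mono_less less_imp_le)
  moreover have "\<sigma> ` {p..<p + q} = {i \<in> {0..<p + q}. i \<notin> \<sigma> ` {..<p}}"
  proof (intro equalityI subsetI)
    fix x assume "x \<in> \<sigma> ` {p..<p + q}"
    then show "x \<in> {i \<in> {0..<p + q}. i \<notin> \<sigma> ` {..<p}}"
      using im by (force simp: mem)
  next
    fix x assume x: "x \<in> {i \<in> {0..<p + q}. i \<notin> \<sigma> ` {..<p}}"
    then have "x \<in> \<sigma> ` {0..<p + q}" unfolding im by simp
    then obtain i where i: "x = \<sigma> i" "i < p + q" by auto
    then show "x \<in> \<sigma> ` {p..<p + q}" using x by (auto simp: mem)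
  qed
  ultimately show "map \<sigma> [p..<p + q] = filter (\<lambda>i. i \<notin> \<sigma> ` {..<p}) [0..<p + q]"
    by (intro sorted_distinct_set_unique) (simp_all add: dist sorted_wrt_filter)
qed

lemma permute_list_Sh:
  assumes \<sigma>: "\<sigma> \<in> Sh p q" and len: "length xs = p + q"
  shows "take p (permute_list \<sigma> xs) = nths xs (\<sigma> ` {..<p})"
    and "drop p (permute_list \<sigma> xs) = nths xs (- \<sigma> ` {..<p})"
proof -
  have eq: "permute_list \<sigma> xs = map ((!) xs) (map \<sigma> [0..<p + q])"
    by (simp add: permute_list_def len)
  show "take p (permute_list \<sigma> xs) = nths xs (\<sigma> ` {..<p})"
    unfolding eq nths_conv_filter len Sh_map_upt(1)[OF \<sigma>, symmetric] by (simp add: take_map)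
  show "drop p (permute_list \<sigma> xs) = nths xs (- \<sigma> ` {..<p})"
    unfolding eq nths_conv_filter len Compl_iff Sh_map_upt(2)[OF \<sigma>, symmetric] by (simp add: drop_map)
qed

text \<open>The size of the image recovers \<open>i\<close>, and \<open>Sh_map_upt\<close> recovers
  \<open>\<sigma>\<close>. Conversely, listing \<open>I\<close> in increasing order and then its
  complement gives a shuffle. The empty set is missing because \<open>i\<close> starts at 1.\<close>

lemma bij_betw_Sh:
  "bij_betw (\<lambda>(i, \<sigma>). \<sigma> ` {..<i}) (SIGMA i:{1..n}. Sh i (n - i)) (Pow {..<n} - {{}})"
proof (rule bij_betw_imageI)
  show "inj_on (\<lambda>(i, \<sigma>). \<sigma> ` {..<i}) (SIGMA i:{1..n}. Sh i (n - i))"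
  proof (rule inj_onI, clarify)
    fix i \<sigma> j \<tau>
    assume i: "i \<in> {1..n}" and j: "j \<in> {1..n}" and \<sigma>: "\<sigma> \<in> Sh i (n - i)" and \<tau>: "\<tau> \<in> Sh j (n - j)"
      and eq: "\<sigma> ` {..<i} = \<tau> ` {..<j}"
    have perm: "\<sigma> permutes {..<n}" "\<tau> permutes {..<n}"
      using \<sigma> \<tau> i j by (auto simp: Sh_def)
    have "card (\<sigma> ` {..<i}) = i" "card (\<tau> ` {..<j}) = j"
      using perm by (simp_all add: card_image permutes_inj_on)
    then have ij: "i = j" using eq by simp
    have "map \<sigma> ([0..<i] @ [i..<n]) = map \<tau> ([0..<i] @ [i..<n])"
      using Sh_map_upt[OF \<sigma>] Sh_map_upt[OF \<tau>] eq i unfolding ij map_append by simp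
    then have "\<sigma> k = \<tau> k" if "k < n" for k
      using that by (fastforce simp: map_eq_conv simp del: map_append)
    moreover have "\<sigma> k = \<tau> k" if "\<not> k < n" for k
      using perm that by (simp add: permutes_not_in)
    ultimately have "\<sigma> = \<tau>" by (auto intro!: ext)
    then show "i = j \<and> \<sigma> = \<tau>" using ij by simp
  qed
  show "(\<lambda>(i, \<sigma>). \<sigma> ` {..<i}) ` (SIGMA i:{1..n}. Sh i (n - i)) = Pow {..<n} - {{}}"
  proof (intro equalityI subsetI)
    fix I assume "I \<in> (\<lambda>(i, \<sigma>). \<sigma> ` {..<i}) ` (SIGMA i:{1..n}. Sh i (n - i))"
    then obtain i \<sigma> where I: "I = \<sigma> ` {..<i}" "i \<in> {1..n}" "\<sigma> permutes {..<n}"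
      by (auto simp: Sh_def)
    then have "\<sigma> ` {..<i} \<subseteq> \<sigma> ` {..<n}" "I \<noteq> {}" by (auto simp: lessThan_empty_iff)
    then show "I \<in> Pow {..<n} - {{}}"
      using I by (simp add: permutes_image)
  next
    fix I assume I: "I \<in> Pow {..<n} - {{}}"
    define as where "as = filter (\<lambda>i. i \<in> I) [0..<n]"
    define bs where "bs = filter (\<lambda>i. i \<notin> I) [0..<n]"
    define \<sigma> where "\<sigma> k = (if k < n then (as @ bs) ! k else k)" for k
    have set_as: "set as = I" using I by (auto simp: as_def)
    have len: "length as + length bs = n"
      using sum_length_filter_compl[of "\<lambda>i. i \<in> I" "[0..<n]"] by (simp add: as_def bs_def)
    have dist: "distinct (as @ bs)" by (auto simp: as_def bs_def)
    have set: "set (as @ bs) = {..<n}" by (auto simp: as_def bs_def)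
    have "bij_betw ((!) (as @ bs)) {..<n} {..<n}"
      using bij_betw_nth[OF dist refl refl] set len by simp
    then have "bij_betw \<sigma> {..<n} {..<n}"
      by (rule bij_betw_cong[THEN iffD1, rotated]) (simp add: \<sigma>_def)
    then have perm: "\<sigma> permutes {..<n}"
      by (rule bij_imp_permutes) (simp add: \<sigma>_def)
    have sorted: "sorted_wrt (<) as" "sorted_wrt (<) bs"
      by (simp_all add: as_def bs_def sorted_wrt_filter)
    have "strict_mono_on {..<length as} \<sigma>"
      using sorted_wrt_nth_less[OF sorted(1)] len by (auto simp: strict_mono_on_def \<sigma>_def nth_append)
    moreover have "strict_mono_on {length as..<n} \<sigma>"
      using sorted_wrt_nth_less[OF sorted(2)] len by (auto simp: strict_mono_on_def \<sigma>_def nth_append)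
    ultimately have "\<sigma> \<in> Sh (length as) (n - length as)"
      using perm len by (auto simp: Sh_def)
    moreover have "\<sigma> ` {..<length as} = (!) as ` {..<length as}"
      using len by (intro image_cong) (auto simp: \<sigma>_def nth_append)
    then have "\<sigma> ` {..<length as} = I"
      using set_as by (simp add: nth_image lessThan_atLeast0)
    moreover have "length as \<in> {1..n}"
      using I len set_as by (cases as) auto
    ultimately show "I \<in> (\<lambda>(i, \<sigma>). \<sigma> ` {..<i}) ` (SIGMA i:{1..n}. Sh i (n - i))"
      by (force intro!: rev_image_eqI[of "(length as, \<sigma>)"])
  qed
qed

lemma finite_Sh: "finite (Sh p q)"
  by (rule finite_subset[OF _ finite_permutations[of "{..<p + q}"]]) (auto simp: Sh_def)

text \<open>The shuffle sum starts at \<open>i = 1\<close> and so lacks the splitting with empty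
  first block; the hypothesis on \<open>F\<close> makes that term vanish on the other side.\<close>

lemma (in vector_space) shuffle_sum_eq_unshuffle_sum:
  assumes F: "F [] ps = 0"
  shows "(\<Sum>i = 1..length ps. \<Sum>\<sigma>\<in>Sh i (length ps - i). scale (koszul_sign (map snd ps) \<sigma>)
      (F (take i (permute_list \<sigma> ps)) (drop i (permute_list \<sigma> ps)))) = unshuffle_sum ps F"
proof -
  let ?n = "length ps"
  let ?t = "\<lambda>I. sg (crossing (map snd ps) I) (F (nths ps I) (nths ps (- I)))"
  let ?S = "SIGMA i:{1..?n}. Sh i (?n - i)"
  have "(\<Sum>i = 1..?n. \<Sum>\<sigma>\<in>Sh i (?n - i). scale (koszul_sign (map snd ps) \<sigma>)
      (F (take i (permute_list \<sigma> ps)) (drop i (permute_list \<sigma> ps)))) =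
      (\<Sum>(i, \<sigma>)\<in>?S. scale (koszul_sign (map snd ps) \<sigma>)
        (F (take i (permute_list \<sigma> ps)) (drop i (permute_list \<sigma> ps))))"
    by (rule sum.Sigma) (simp_all add: finite_Sh)
  also have "\<dots> = (\<Sum>x\<in>?S. ?t ((\<lambda>(i, \<sigma>). \<sigma> ` {..<i}) x))"
  proof (rule sum.cong[OF refl], clarify)
    fix i \<sigma> assume i: "i \<in> {1..?n}" and \<sigma>: "\<sigma> \<in> Sh i (?n - i)"
    then have len: "length ps = i + (?n - i)" by simp
    show "scale (koszul_sign (map snd ps) \<sigma>)
        (F (take i (permute_list \<sigma> ps)) (drop i (permute_list \<sigma> ps))) = ?t (\<sigma> ` {..<i})"
      using len by (simp add: koszul_sign_shuffle[OF \<sigma>] permute_list_Sh[OF \<sigma> len] scale_powi_minus_1)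
  qed
  also have "\<dots> = sum ?t (Pow {..<?n} - {{}})"
    by (rule sum.reindex_bij_betw[OF bij_betw_Sh])
  also have "\<dots> = sum ?t (Pow {..<?n})"
    by (rule sum.mono_neutral_left) (auto simp: F nths_all)
  also have "\<dots> = unshuffle_sum ps F"
    by (rule unshuffle_sum_subsets[symmetric])
  finally show ?thesis .
qed

section \<open>Symmetry from adjacent transpositions\<close>

text \<open>Relabelling positions by \<open>s\<close> matches the inversions of
  \<open>\<sigma> \<circ> s\<close> with those of \<open>\<sigma>\<close> other than
  \<open>(k, Suc k)\<close>. Undoing a descent thus costs exactly one sign factor, and the number of
  inversions can serve as a measure.\<close>

lemma koszul_sign_descent:
  assumes k: "Suc k < length ds" "\<sigma> (Suc k) < \<sigma> k"
  defines "s \<equiv> transpose k (Suc k)"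
  shows "(koszul_sign ds \<sigma> :: 'k::field) =
      (- 1) powi (ds ! \<sigma> k * ds ! \<sigma> (Suc k)) * koszul_sign ds (\<sigma> \<circ> s)"
    and "card {(i, j). i < j \<and> j < length ds \<and> (\<sigma> \<circ> s) j < (\<sigma> \<circ> s) i} <
      card {(i, j). i < j \<and> j < length ds \<and> \<sigma> j < \<sigma> i}"
proof -
  let ?Inv = "\<lambda>\<sigma>. {(i, j). i < j \<and> j < length ds \<and> \<sigma> j < \<sigma> i}"
  let ?f = "\<lambda>(i, j). (- 1 :: 'k) powi (ds ! \<sigma> i * ds ! \<sigma> j)"
  have fin: "finite (?Inv \<tau>)" for \<tau> :: "nat \<Rightarrow> nat"
    by (rule finite_subset[of _ "{..<length ds} \<times> {..<length ds}"]) auto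
  have s_less: "s i < s j" if "i < j" "(i, j) \<noteq> (k, Suc k)" for i j
    using that by (auto simp: s_def transpose_def)
  have s_bound: "s j < length ds \<longleftrightarrow> j < length ds" for j
    using k(1) by (auto simp: s_def transpose_def)
  have ss: "s (s i) = i" for i
    by (simp add: s_def)
  have sk: "s k = Suc k" "s (Suc k) = k"
    by (simp_all add: s_def)
  have image: "map_prod s s ` ?Inv (\<sigma> \<circ> s) = ?Inv \<sigma> - {(k, Suc k)}"
  proof (intro equalityI subsetI)
    fix x assume "x \<in> map_prod s s ` ?Inv (\<sigma> \<circ> s)"
    then obtain i j where ij: "x = (s i, s j)" "i < j" "j < length ds" "\<sigma> (s j) < \<sigma> (s i)"
      by auto
    moreover have "(i, j) \<noteq> (k, Suc k)"
      using ij(4) k(2) sk by auto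
    moreover have "(s i, s j) \<noteq> (k, Suc k)"
      using ij(2) ss[of i] ss[of j] sk by auto
    ultimately show "x \<in> ?Inv \<sigma> - {(k, Suc k)}"
      using s_less[of i j] s_bound by simp
  next
    fix x assume "x \<in> ?Inv \<sigma> - {(k, Suc k)}"
    then obtain i j where ij: "x = (i, j)" "i < j" "j < length ds" "\<sigma> j < \<sigma> i" "(i, j) \<noteq> (k, Suc k)"
      by auto
    then have "(s i, s j) \<in> ?Inv (\<sigma> \<circ> s)" "x = map_prod s s (s i, s j)"
      using s_less[of i j] s_bound by (simp_all add: ss)
    then show "x \<in> map_prod s s ` ?Inv (\<sigma> \<circ> s)" by blast
  qed
  have inj: "inj_on (map_prod s s) X" for X
    by (rule inj_onI) (metis map_prod_simp prod.collapse prod.inject ss)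
  have mem: "(k, Suc k) \<in> ?Inv \<sigma>"
    using k by simp
  have "koszul_sign ds \<sigma> = prod ?f (?Inv \<sigma>)"
    unfolding koszul_sign_def by simp
  moreover have "prod ?f (?Inv \<sigma>) = ?f (k, Suc k) * prod ?f (map_prod s s ` ?Inv (\<sigma> \<circ> s))"
    unfolding image by (rule prod.remove[OF fin mem])
  moreover have "prod ?f (map_prod s s ` ?Inv (\<sigma> \<circ> s)) = koszul_sign ds (\<sigma> \<circ> s)"
    unfolding koszul_sign_def by (subst prod.reindex[OF inj]) (simp add: comp_def case_prod_beta)
  ultimately show "koszul_sign ds \<sigma> = (- 1 :: 'k) powi (ds ! \<sigma> k * ds ! \<sigma> (Suc k)) * koszul_sign ds (\<sigma> \<circ> s)"
    by (simp only: split)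
  have "card (?Inv (\<sigma> \<circ> s)) = card (?Inv \<sigma> - {(k, Suc k)})"
    unfolding image[symmetric] by (rule card_image[OF inj, symmetric])
  also have "\<dots> < card (?Inv \<sigma>)"
    using fin mem by (rule card_Diff1_less)
  finally show "card (?Inv (\<sigma> \<circ> s)) < card (?Inv \<sigma>)" .
qed

lemma permutes_no_descent:
  assumes perm: "\<sigma> permutes {..<n}" and "\<And>k. Suc k < n \<Longrightarrow> \<sigma> k \<le> \<sigma> (Suc k)"
  shows "\<sigma> = id"
proof -
  have "map \<sigma> [0..<n] = [0..<n]"
  proof (rule sorted_distinct_set_unique)
    show "sorted (map \<sigma> [0..<n])"
      using assms(2) by (simp add: sorted_iff_nth_Suc)
    show "distinct (map \<sigma> [0..<n])"
      using permutes_inj[OF perm] by (simp add: distinct_map inj_on_def)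
    show "set (map \<sigma> [0..<n]) = set [0..<n]"
      using permutes_image[OF perm] by (simp add: atLeast0LessThan)
  qed simp_all
  then have "\<sigma> k = k" if "k < n" for k
    using that by (metis add_0 diff_zero length_upt nth_map nth_upt)
  then show ?thesis
    using permutes_not_in[OF perm] by (metis eq_id_iff lessThan_iff)
qed

text \<open>The axioms short of the Jacobi identities, in a form that is easy to verify: symmetry is
  required only for neighbouring entries. The degree condition includes the empty list, where it is
  consistent with \<open>l [] = 0\<close>.\<close>

locale symmetric_brackets = graded_vector_space scale G
  for scale :: "'k::field \<Rightarrow> 'v::ab_group_add \<Rightarrow> 'v" and G :: "int \<Rightarrow> 'v set" +
  fixes l :: "'v list \<Rightarrow> 'v"
  assumes l_Nil: "l [] = 0"
    and slot_linear: "Vector_Spaces.linear scale scale (\<lambda>x. l (xs @ x # ys))"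
    and l_degree: "\<forall>p\<in>set ps. fst p \<in> G (snd p) \<Longrightarrow> l (map fst ps) \<in> G (deg ps + 1)"
    and l_swap: "\<forall>p\<in>set (us @ p # q # vs). fst p \<in> G (snd p) \<Longrightarrow>
      l (map fst (us @ p # q # vs)) = sg (snd p * snd q) (l (map fst (us @ q # p # vs)))"
begin

text \<open>Bubble sort: each descent of \<open>\<sigma>\<close> is removed by
  \<open>l_swap\<close>, whose sign is the factor of that inversion in the Koszul sign.\<close>

lemma permute_list_eq_koszul_sign:
  assumes "\<sigma> permutes {..<length ps}" and hom: "\<forall>p\<in>set ps. fst p \<in> G (snd p)"
  shows "l (map fst (permute_list \<sigma> ps)) = scale (koszul_sign (map snd ps) \<sigma>) (l (map fst ps))"
  using assms(1)
proof (induction "card {(i, j). i < j \<and> j < length (map snd ps) \<and> \<sigma> j < \<sigma> i}"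
    arbitrary: \<sigma> rule: less_induct)
  case less
  show ?case
  proof (cases "\<exists>k. Suc k < length ps \<and> \<sigma> (Suc k) < \<sigma> k")
    case False
    then have "\<sigma> = id"
      by (intro permutes_no_descent[OF less.prems]) (meson not_le_imp_less)
    then show ?thesis
      by (simp add: koszul_sign_def cong: conj_cong)
  next
    case True
    then obtain k where k: "Suc k < length ps" "\<sigma> (Suc k) < \<sigma> k" by blast
    define s where "s = transpose k (Suc k)"
    have s_perm: "s permutes {..<length ps}"
      using k by (auto simp: s_def intro: permutes_swap_id)
    then have perm: "\<sigma> \<circ> s permutes {..<length ps}"
      using less.prems by (rule permutes_compose)
    let ?zs = "permute_list \<sigma> ps"
    let ?us = "take k ?zs" and ?vs = "drop (Suc (Suc k)) ?zs"
    have zs: "?zs = ?us @ ?zs ! k # ?zs ! Suc k # ?vs"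
      using k by (simp add: Cons_nth_drop_Suc)
    have "permute_list (\<sigma> \<circ> s) ps = permute_list s ?zs"
      using s_perm by (rule permute_list_compose)
    also have "\<dots> = ?us @ ?zs ! Suc k # ?zs ! k # ?vs"
      using k by (intro nth_equalityI)
        (auto simp: permute_list_def s_def transpose_def nth_append nth_Cons' not_less
          intro!: arg_cong[of _ _ "\<lambda>i. ps ! \<sigma> i"])
    finally have swapped: "permute_list (\<sigma> \<circ> s) ps = ?us @ ?zs ! Suc k # ?zs ! k # ?vs" .
    have hom': "\<forall>p\<in>set ?zs. fst p \<in> G (snd p)"
      using hom less.prems by simp
    have nth: "?zs ! k = ps ! \<sigma> k" "?zs ! Suc k = ps ! \<sigma> (Suc k)"
      using k less.prems by (simp_all add: permute_list_nth)
    have bound: "\<sigma> k < length ps" "\<sigma> (Suc k) < length ps"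
      using k permutes_in_image[OF less.prems] by simp_all
    have "l (map fst ?zs) = sg (snd (?zs ! k) * snd (?zs ! Suc k)) (l (map fst (permute_list (\<sigma> \<circ> s) ps)))"
      using hom' unfolding swapped by (subst (1) zs, subst (asm) zs) (rule l_swap)
    also have "l (map fst (permute_list (\<sigma> \<circ> s) ps)) =
        scale (koszul_sign (map snd ps) (\<sigma> \<circ> s)) (l (map fst ps))"
      using perm k less.prems unfolding s_def
      by (intro less.hyps koszul_sign_descent(2)) simp_all
    also have "sg (snd (?zs ! k) * snd (?zs ! Suc k)) \<dots> =
        scale (koszul_sign (map snd ps) \<sigma>) (l (map fst ps))"
      using koszul_sign_descent(1)[where 'k = 'k and k = k and \<sigma> = \<sigma> and ds = "map snd ps"] k less.prems bound
      by (simp add: nth s_def flip: scale_powi_minus_1)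
    finally show ?thesis .
  qed
qed

lemma slot_add: "l (xs @ (x + y) # ys) = l (xs @ x # ys) + l (xs @ y # ys)"
  using slot_linear[of xs ys] unfolding Vector_Spaces.linear_iff by blast

lemma slot_scale: "l (xs @ scale c x # ys) = scale c (l (xs @ x # ys))"
  using slot_linear[of xs ys] unfolding Vector_Spaces.linear_iff by blast

lemma additive_head: "additive (\<lambda>x. l (x # ys))"
  by standard (use slot_add[of "[]"] in simp)

lemmas head_zero [simp] = additive.zero[OF additive_head]
lemmas head_add = additive.add[OF additive_head]

definition jacobiator :: "('v \<times> int) list \<Rightarrow> 'v" where
  "jacobiator ps = unshuffle_sum ps (\<lambda>u v. l (l (map fst u) # map fst v))"

end

locale unshuffle_L_infinity = symmetric_brackets scale G l
  for scale :: "'k::field \<Rightarrow> 'v::ab_group_add \<Rightarrow> 'v" and G :: "int \<Rightarrow> 'v set" and l :: "'v list \<Rightarrow> 'v" +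
  assumes jacobiator_eq_0: "\<forall>p\<in>set ps. fst p \<in> G (snd p) \<Longrightarrow> jacobiator ps = 0"

text \<open>Zipping the arguments with their degrees translates between the two formats, and
  \<open>l [] = 0\<close> makes the shuffle sum agree with the unshuffle sum.\<close>

sublocale unshuffle_L_infinity \<subseteq> L_infinity_1_algebra scale G l
proof (intro L_infinity_1_algebra.intro L_infinity_1_algebra_axioms.intro)
  show "graded_vector_space scale G" by (rule graded_vector_space_axioms)
  have zip: "\<forall>p\<in>set (zip xs ds). fst p \<in> G (snd p)" "map fst (zip xs ds) = xs" "map snd (zip xs ds) = ds"
    "length (zip xs ds) = length xs"
    if "list_all2 (\<lambda>x d. x \<in> G d) xs ds" for xs ds
    using that by (auto simp: list_all2_iff)
  show "l [] = 0" by (rule l_Nil)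
  show "Vector_Spaces.linear scale scale (\<lambda>x. l (xs @ x # ys))" for xs ys
    by (rule slot_linear)
  show "l xs \<in> G (sum_list ds + 1)" if "xs \<noteq> []" "list_all2 (\<lambda>x d. x \<in> G d) xs ds" for xs ds
    using l_degree[OF zip(1)[OF that(2)]] by (simp add: zip[OF that(2)])
  show "l (permute_list \<sigma> xs) = scale (koszul_sign ds \<sigma>) (l xs)"
    if xs: "list_all2 (\<lambda>x d. x \<in> G d) xs ds" and \<sigma>: "\<sigma> permutes {..<length xs}" for xs ds \<sigma>
    using permute_list_eq_koszul_sign[of \<sigma> "zip xs ds"] \<sigma> permute_list_map[of \<sigma> "zip xs ds" fst]
    unfolding zip(4)[OF xs] by (simp add: zip(1-3)[OF xs])
  show "(\<Sum>i = 1..n. \<Sum>\<sigma>\<in>Sh i (n - i). scale (koszul_sign ds \<sigma>)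
         (l (l (take i (permute_list \<sigma> xs)) # drop i (permute_list \<sigma> xs)))) = 0"
    if n: "1 \<le> n" "length xs = n" and xs: "list_all2 (\<lambda>x d. x \<in> G d) xs ds" for n xs ds
  proof -
    let ?ps = "zip xs ds"
    have map: "permute_list \<sigma> xs = map fst (permute_list \<sigma> ?ps)" if "\<sigma> \<in> Sh i (n - i)" "i \<le> n" for i \<sigma>
      using permute_list_map[of \<sigma> ?ps fst] that n unfolding zip(2,4)[OF xs] by (simp add: Sh_def)
    have "(\<Sum>i = 1..n. \<Sum>\<sigma>\<in>Sh i (n - i). scale (koszul_sign ds \<sigma>)
         (l (l (take i (permute_list \<sigma> xs)) # drop i (permute_list \<sigma> xs)))) =
       (\<Sum>i = 1..length ?ps. \<Sum>\<sigma>\<in>Sh i (length ?ps - i). scale (koszul_sign (map snd ?ps) \<sigma>)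
         (l (l (map fst (take i (permute_list \<sigma> ?ps))) # map fst (drop i (permute_list \<sigma> ?ps)))))"
      unfolding zip[OF xs] n(2) by (intro sum.cong refl) (auto simp: map take_map drop_map)
    also have "\<dots> = jacobiator ?ps"
      unfolding jacobiator_def by (rule shuffle_sum_eq_unshuffle_sum) (simp add: l_Nil)
    also have "\<dots> = 0"
      by (rule jacobiator_eq_0) (rule zip(1)[OF xs])
    finally show ?thesis .
  qed
qed

section \<open>Twisting, rescaling and restricting the operations\<close>

lemma (in vector_space) double_eq_0: "(2::'a) \<noteq> 0 \<Longrightarrow> v + v = (0::'b) \<Longrightarrow> v = 0"
  using scale_left_distrib[of 1 1 v] by simp

context unshuffle_L_infinity
begin

text \<open>In general the twisted operation sums \<open>l(\<delta>, ..., \<delta>, xs) / k!\<close>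
  over the number \<open>k\<close> of insertions; here it stops at \<open>k = 1\<close>. The
  condition \<open>l [\<delta>] = 0\<close> keeps the value at the empty list equal to 0. The new
  Jacobi identity combines the old ones for \<open>ps\<close> preceded by zero, one and two copies
  of \<open>\<delta>\<close>.\<close>

lemma twist:
  assumes two: "(2::'k) \<noteq> 0"
    and \<delta>: "\<delta> \<in> G 0" "l [\<delta>] = 0" "\<And>xs. l (\<delta> # \<delta> # xs) = 0"
  shows "unshuffle_L_infinity scale G (\<lambda>xs. l xs + l (\<delta> # xs))"
proof -
  let ?l = "\<lambda>xs. l xs + l (\<delta> # xs)"
  interpret t: symmetric_brackets scale G ?l
  proof (intro symmetric_brackets.intro symmetric_brackets_axioms.intro)
    show "graded_vector_space scale G" by (rule graded_vector_space_axioms)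
    show "?l [] = 0" by (simp add: l_Nil \<delta>)
    show "Vector_Spaces.linear scale scale (\<lambda>x. ?l (xs @ x # ys))" for xs ys
      using vector_space_axioms slot_add[of "\<delta> # xs"] slot_scale[of "\<delta> # xs"]
      by (simp add: Vector_Spaces.linear_iff slot_add slot_scale scale_right_distrib)
    show "?l (map fst ps) \<in> G (deg ps + 1)" if "\<forall>p\<in>set ps. fst p \<in> G (snd p)" for ps
      using that l_degree[of ps] l_degree[of "(\<delta>, 0) # ps"] \<delta>(1) by (auto intro: subspace_add[OF subspace_component])
    show "?l (map fst (us @ p # q # vs)) = sg (snd p * snd q) (?l (map fst (us @ q # p # vs)))"
      if "\<forall>p\<in>set (us @ p # q # vs). fst p \<in> G (snd p)" for us p q vs
      using that l_swap[of us p q vs] l_swap[of "(\<delta>, 0) # us" p q vs] \<delta>(1) by (simp add: sg_add)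
  qed
  \<comment> \<open>As \<open>\<delta>\<close> has degree 0, it passes any argument without a
    sign.\<close>
  have move: "l (x # \<delta> # map fst v) = l (\<delta> # x # map fst v)"
    if "x \<in> G d" "\<forall>p\<in>set v. fst p \<in> G (snd p)" for x d v
    using l_swap[of "[]" "(x, d)" "(\<delta>, 0)" v] that \<delta>(1) by simp
  have move2: "l (x # \<delta> # \<delta> # map fst v) = 0"
    if "x \<in> G d" "\<forall>p\<in>set v. fst p \<in> G (snd p)" for x d v
    using move[of x d "(\<delta>, 0) # v"] l_swap[of "[(\<delta>, 0)]" "(x, d)" "(\<delta>, 0)" v] that \<delta> by simp
  have "t.jacobiator ps = 0" if hom: "\<forall>p\<in>set ps. fst p \<in> G (snd p)" for ps
  proof -
    let ?a = "unshuffle_sum ps (\<lambda>u v. l (l (map fst u) # map fst v))"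
    let ?b = "unshuffle_sum ps (\<lambda>u v. l (l (\<delta> # map fst u) # map fst v))"
    let ?c = "unshuffle_sum ps (\<lambda>u v. l (l (map fst u) # \<delta> # map fst v))"
    let ?d = "unshuffle_sum ps (\<lambda>u v. l (l (\<delta> # map fst u) # \<delta> # map fst v))"
    have deg_u: "l (map fst u) \<in> G (deg u + 1)" "l (\<delta> # map fst u) \<in> G (deg u + 1)"
      if "set u \<union> set v = set ps" for u v :: "('v \<times> int) list"
    proof -
      have "\<forall>p\<in>set u. fst p \<in> G (snd p)" using hom that by blast
      then show "l (map fst u) \<in> G (deg u + 1)" "l (\<delta> # map fst u) \<in> G (deg u + 1)"
        using l_degree[of u] l_degree[of "(\<delta>, 0) # u"] \<delta>(1) by simp_all
    qed
    have "jacobiator ps = 0" "jacobiator ((\<delta>, 0) # ps) = 0" "jacobiator ((\<delta>, 0) # (\<delta>, 0) # ps) = 0"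
      using hom \<delta>(1) by (simp_all add: jacobiator_eq_0)
    \<comment> \<open>Each inserted \<open>\<delta>\<close> falls into the inner or the outer
      operation. With two copies, \<open>?d\<close> arises twice, once for either copy inside; both
      copies inside give 0.\<close>
    then have J: "?a = 0" "?b + ?c = 0"
      "?d + (?d + unshuffle_sum ps (\<lambda>u v. l (l (map fst u) # \<delta> # \<delta> # map fst v))) = 0"
      by (simp_all add: jacobiator_def \<delta> del: unshuffle_sum.simps(1))
    have "unshuffle_sum ps (\<lambda>u v. l (l (map fst u) # \<delta> # \<delta> # map fst v)) = unshuffle_sum ps (\<lambda>u v. 0)"
    proof (rule unshuffle_sum_cong)
      fix u v assume uv: "set u \<union> set v = set ps"
      then have "\<forall>p\<in>set v. fst p \<in> G (snd p)" using hom by blast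
      then show "l (l (map fst u) # \<delta> # \<delta> # map fst v) = 0"
        by (rule move2[OF deg_u(1)[OF uv]])
    qed
    then have "?d = 0"
      using J(3) by - (rule double_eq_0[OF two], simp)
    have "t.jacobiator ps = unshuffle_sum ps (\<lambda>u v. l (l (map fst u) # map fst v) +
        l (l (\<delta> # map fst u) # map fst v) + l (l (map fst u) # \<delta> # map fst v) +
        l (l (\<delta> # map fst u) # \<delta> # map fst v))"
      unfolding t.jacobiator_def
    proof (rule unshuffle_sum_cong)
      fix u v assume uv: "set u \<union> set v = set ps"
      then have v: "\<forall>p\<in>set v. fst p \<in> G (snd p)" using hom by blast
      have slot: "l (\<delta> # (x + y) # map fst v) = l (\<delta> # x # map fst v) + l (\<delta> # y # map fst v)" for x y
        using slot_add[of "[\<delta>]"] by simp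
      show "l (?l (map fst u) # map fst v) + l (\<delta> # ?l (map fst u) # map fst v) =
        l (l (map fst u) # map fst v) +
        l (l (\<delta> # map fst u) # map fst v) + l (l (map fst u) # \<delta> # map fst v) +
        l (l (\<delta> # map fst u) # \<delta> # map fst v)"
        using move[OF deg_u(1)[OF uv] v] move[OF deg_u(2)[OF uv] v]
        by (simp add: head_add slot algebra_simps)
    qed
    also have "\<dots> = ?a + (?b + ?c) + ?d"
      by (simp add: unshuffle_sum_add algebra_simps)
    finally show ?thesis
      using J \<open>?d = 0\<close> by simp
  qed
  then show ?thesis by unfold_locales
qed

lemma additive_scale: "additive (scale c)"
  by standard (rule scale_right_distrib)

text \<open>The inner exponent \<open>length u - 1\<close> and the outer exponent
  \<open>length v\<close> add up to \<open>length ps - 1\<close> for every splitting with nonempty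
  \<open>u\<close>, so the whole jacobiator acquires a single factor.\<close>

lemma rescale: "unshuffle_L_infinity scale G (\<lambda>xs. scale (c ^ (length xs - 1)) (l xs))"
proof -
  let ?l = "\<lambda>xs. scale (c ^ (length xs - 1)) (l xs)"
  interpret t: symmetric_brackets scale G ?l
  proof (intro symmetric_brackets.intro symmetric_brackets_axioms.intro)
    show "graded_vector_space scale G" by (rule graded_vector_space_axioms)
    show "?l [] = 0" by (simp add: l_Nil)
    show "Vector_Spaces.linear scale scale (\<lambda>x. ?l (xs @ x # ys))" for xs ys
      using vector_space_axioms
      by (simp add: Vector_Spaces.linear_iff slot_add slot_scale scale_right_distrib mult.commute)
    show "?l (map fst ps) \<in> G (deg ps + 1)" if "\<forall>p\<in>set ps. fst p \<in> G (snd p)" for ps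
      using l_degree[OF that] by (rule subspace_scale[OF subspace_component])
    show "?l (map fst (us @ p # q # vs)) = sg (snd p * snd q) (?l (map fst (us @ q # p # vs)))"
      if "\<forall>p\<in>set (us @ p # q # vs). fst p \<in> G (snd p)" for us p q vs
      using l_swap[OF that] sg_hom[OF additive_scale] by simp
  qed
  have "t.jacobiator ps = 0" if hom: "\<forall>p\<in>set ps. fst p \<in> G (snd p)" for ps
  proof -
    have "t.jacobiator ps = unshuffle_sum ps (\<lambda>u v. scale (c ^ (length ps - 1)) (l (l (map fst u) # map fst v)))"
      unfolding t.jacobiator_def
    proof (rule unshuffle_sum_cong)
      fix u v :: "('v \<times> int) list" assume len: "length u + length v = length ps"
      show "?l (?l (map fst u) # map fst v) = scale (c ^ (length ps - 1)) (l (l (map fst u) # map fst v))"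
      proof (cases u)
        \<comment> \<open>Here truncated subtraction would spoil the count of exponents, but the
          term vanishes since \<open>l [] = 0\<close>.\<close>
        case Nil
        then show ?thesis by (simp add: l_Nil)
      next
        case (Cons p u')
        then have "length ps - 1 = length v + (length u - 1)" using len by simp
        then show ?thesis
          using slot_scale[of "[]"] by (simp add: power_add)
      qed
    qed
    also have "\<dots> = 0"
      using jacobiator_eq_0[OF hom] by (simp add: unshuffle_sum_hom[OF additive_scale] jacobiator_def)
    finally show ?thesis .
  qed
  then show ?thesis by unfold_locales
qed

text \<open>Every axiom is checked after applying the injective \<open>\<phi>\<close>. The grading
  hypothesis is an equivalence because degrees in \<open>H\<close> have to be recovered from degrees
  in \<open>G\<close>.\<close>

lemma restrict:
  fixes t :: "'k \<Rightarrow> 'w::ab_group_add \<Rightarrow> 'w"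
  assumes "graded_vector_space t H" and linear: "Vector_Spaces.linear t scale \<phi>" and inj: "inj \<phi>"
    and grading: "\<And>x n. \<phi> x \<in> G n \<longleftrightarrow> x \<in> H n"
    and l': "\<And>xs. \<phi> (l' xs) = l (map \<phi> xs)"
  shows "unshuffle_L_infinity t H l'"
proof -
  interpret H: graded_vector_space t H by fact
  interpret \<phi>: Vector_Spaces.linear t scale \<phi> by fact
  have add: "additive \<phi>" by standard (rule \<phi>.add)
  have eqI: "x = y" if "\<phi> x = \<phi> y" for x y
    using that inj by (simp add: inj_eq)
  interpret t: symmetric_brackets t H l'
  proof (intro symmetric_brackets.intro symmetric_brackets_axioms.intro)
    show "graded_vector_space t H" by fact
    show "l' [] = 0" by (rule eqI) (simp add: l' l_Nil)
    show "Vector_Spaces.linear t t (\<lambda>x. l' (xs @ x # ys))" for xs ys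
      using H.vector_space_axioms
      by (auto simp: Vector_Spaces.linear_iff l' \<phi>.add \<phi>.scale slot_add slot_scale intro!: eqI)
    show "l' (map fst ps) \<in> H (deg ps + 1)" if "\<forall>p\<in>set ps. fst p \<in> H (snd p)" for ps
      using l_degree[of "map (apfst \<phi>) ps"] that by (simp add: l' comp_def flip: grading)
    show "l' (map fst (us @ p # q # vs)) = sg (snd p * snd q) (l' (map fst (us @ q # p # vs)))"
      if "\<forall>p\<in>set (us @ p # q # vs). fst p \<in> H (snd p)" for us p q vs
      using l_swap[of "map (apfst \<phi>) us" "apfst \<phi> p" "apfst \<phi> q" "map (apfst \<phi>) vs"] that
      by (intro eqI) (simp add: l' sg_hom[OF add] grading comp_def ball_Un)
  qed
  have "t.jacobiator ps = 0" if "\<forall>p\<in>set ps. fst p \<in> H (snd p)" for ps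
  proof (rule eqI)
    have "\<phi> (t.jacobiator ps) = jacobiator (map (apfst \<phi>) ps)"
      unfolding t.jacobiator_def jacobiator_def
      by (simp add: l' unshuffle_sum_map comp_def flip: unshuffle_sum_hom[OF add])
    also have "\<dots> = 0"
      using that by (intro jacobiator_eq_0) (simp add: grading)
    finally show "\<phi> (t.jacobiator ps) = \<phi> 0" by simp
  qed
  then show ?thesis by unfold_locales
qed

end

section \<open>Components and the parity involution of a graded vector space\<close>

context graded_vector_space
begin

lemma zero_mem: "0 \<in> G n"
  using subspace_component[of n] by (rule subspace_0)

lemma add_mem: "x \<in> G n \<Longrightarrow> y \<in> G n \<Longrightarrow> x + y \<in> G n"
  using subspace_component[of n] by (rule subspace_add)

lemma diff_mem: "x \<in> G n \<Longrightarrow> y \<in> G n \<Longrightarrow> x - y \<in> G n"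
  using subspace_component[of n] by (rule subspace_diff)

lemma scale_mem: "x \<in> G n \<Longrightarrow> scale c x \<in> G n"
  using subspace_component[of n] by (rule subspace_scale)

lemma sg_mem: "x \<in> G n \<Longrightarrow> sg m x \<in> G n"
  using scale_mem[of x n "(- 1) powi m"] by (simp add: scale_powi_minus_1)

definition component :: "'v \<Rightarrow> int \<Rightarrow> 'v" where
  "component v = (THE x. (\<forall>n. x n \<in> G n) \<and> finite {n. x n \<noteq> 0} \<and> v = (\<Sum>n | x n \<noteq> 0. x n))"

lemma component_mem: "component v n \<in> G n"
  and finite_component: "finite {n. component v n \<noteq> 0}"
  and sum_component: "(\<Sum>n | component v n \<noteq> 0. component v n) = v"
  using theI'[OF direct_sum[of v]] unfolding component_def[symmetric] by simp_all

lemma component_eqI: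
  assumes "finite S" and "\<And>n. n \<in> S \<Longrightarrow> x n \<in> G n" and v: "v = (\<Sum>n\<in>S. x n)"
  shows "component v n = (if n \<in> S then x n else 0)"
proof -
  let ?y = "\<lambda>n. if n \<in> S then x n else 0"
  have "{n. ?y n \<noteq> 0} \<subseteq> S" by auto
  then have "(\<Sum>n | ?y n \<noteq> 0. ?y n) = (\<Sum>n\<in>S. ?y n)"
    using assms(1) by (intro sum.mono_neutral_left) auto
  then have "v = (\<Sum>n | ?y n \<noteq> 0. ?y n)"
    using v by (simp cong: sum.cong)
  moreover have "finite {n. ?y n \<noteq> 0}"
    using assms(1) \<open>{n. ?y n \<noteq> 0} \<subseteq> S\<close> by (rule finite_subset[rotated])
  ultimately have "component v = ?y"
    unfolding component_def using assms(2)
    by (intro the1_equality[OF direct_sum]) (simp add: zero_mem)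
  then show ?thesis by simp
qed

lemma sum_component_superset:
  "finite S \<Longrightarrow> {n. component v n \<noteq> 0} \<subseteq> S \<Longrightarrow> (\<Sum>n\<in>S. component v n) = v"
  by (subst (2) sum_component[of v, symmetric], rule sum.mono_neutral_right) auto

lemma component_add: "component (v + w) n = component v n + component w n"
proof -
  let ?S = "{n. component v n \<noteq> 0} \<union> {n. component w n \<noteq> 0}"
  have "v + w = (\<Sum>n\<in>?S. component v n + component w n)"
    by (simp add: sum.distrib sum_component_superset finite_component)
  then have "component (v + w) n = (if n \<in> ?S then component v n + component w n else 0)"
    by (intro component_eqI) (simp_all add: finite_component component_mem add_mem)
  then show ?thesis by auto
qed

lemma component_scale: "component (scale c v) n = scale c (component v n)"
proof -
  let ?S = "{n. component v n \<noteq> 0}"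
  have "scale c v = (\<Sum>n\<in>?S. scale c (component v n))"
    by (simp add: sum_component flip: scale_sum_right)
  then have "component (scale c v) n = (if n \<in> ?S then scale c (component v n) else 0)"
    by (intro component_eqI) (simp_all add: finite_component component_mem scale_mem)
  then show ?thesis by auto
qed

lemma component_homogeneous: "v \<in> G n \<Longrightarrow> component v m = (if m = n then v else 0)"
  using component_eqI[of "{n}" "\<lambda>_. v" v m] by simp

lemma additive_eqI:
  assumes f: "additive f" and g: "additive g" and eq: "\<And>x n. x \<in> G n \<Longrightarrow> f x = g x"
  shows "f v = g v"
proof -
  have "f v = (\<Sum>n | component v n \<noteq> 0. f (component v n))"
    by (subst sum_component[of v, symmetric]) (rule additive.sum[OF f])
  also have "\<dots> = (\<Sum>n | component v n \<noteq> 0. g (component v n))"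
    by (intro sum.cong refl eq[OF component_mem])
  also have "\<dots> = g v"
    by (subst (3) sum_component[of v, symmetric]) (rule additive.sum[OF g, symmetric])
  finally show ?thesis .
qed

text \<open>The grading involution. It lets a sign such as \<open>(- 1)^|f|\<close> enter a formula
  that must be linear in \<open>f\<close>, where \<open>f\<close> need not have a degree.\<close>

definition parity :: "'v \<Rightarrow> 'v" where
  "parity v = (\<Sum>n | component v n \<noteq> 0. sg n (component v n))"

lemma parity_superset:
  "finite S \<Longrightarrow> {n. component v n \<noteq> 0} \<subseteq> S \<Longrightarrow> parity v = (\<Sum>n\<in>S. sg n (component v n))"
  unfolding parity_def by (rule sum.mono_neutral_left) auto

lemma parity_homogeneous: "v \<in> G n \<Longrightarrow> parity v = sg n v"
  by (subst parity_superset[of "{n}"]) (auto simp: component_homogeneous)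

lemma parity_add: "parity (v + w) = parity v + parity w"
proof -
  let ?S = "{n. component v n \<noteq> 0} \<union> {n. component w n \<noteq> 0}"
  have "finite ?S" by (simp add: finite_component)
  moreover have "{n. component (v + w) n \<noteq> 0} \<subseteq> ?S"
    by (auto simp: component_add)
  ultimately show ?thesis
    by (simp add: parity_superset[of ?S] component_add sg_add sum.distrib)
qed

lemma parity_scale: "parity (scale c v) = scale c (parity v)"
proof -
  have "{n. component (scale c v) n \<noteq> 0} \<subseteq> {n. component v n \<noteq> 0}"
    by (auto simp: component_scale)
  moreover have "additive (scale c)"
    by standard (rule scale_right_distrib)
  ultimately show ?thesis
    unfolding parity_def[of v]
    by (simp add: parity_superset[OF finite_component] component_scale scale_sum_right sg_hom)
qed

lemma graded_vector_space_suspension: "graded_vector_space scale (suspension G)"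
proof
  show "subspace (suspension G n)" for n
    unfolding suspension_def by (rule subspace_component)
  fix v
  let ?P = "\<lambda>x. (\<forall>n. x n \<in> suspension G n) \<and> finite {n. x n \<noteq> 0} \<and> v = (\<Sum>n | x n \<noteq> 0. x n)"
  have "finite ((\<lambda>n. n - 1) ` {n. component v n \<noteq> 0})"
    by (intro finite_imageI finite_component)
  also have "(\<lambda>n. n - 1) ` {n. component v n \<noteq> 0} = {n. component v (n + 1) \<noteq> 0}"
    by (force simp: image_iff)
  finally have "finite {n. component v (n + 1) \<noteq> 0}" .
  moreover have "(\<Sum>n | component v (n + 1) \<noteq> 0. component v (n + 1)) = (\<Sum>n | component v n \<noteq> 0. component v n)"
    by (rule sum.reindex_bij_witness[of _ "\<lambda>n. n - 1" "\<lambda>n. n + 1"]) simp_all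
  ultimately have "?P (\<lambda>n. component v (n + 1))"
    by (simp add: suspension_def component_mem sum_component)
  moreover have "x = (\<lambda>n. component v (n + 1))" if x: "?P x" for x
  proof
    fix n
    have "v = (\<Sum>n\<in>(\<lambda>n. n + 1) ` {n. x n \<noteq> 0}. x (n - 1))"
      using x by (simp add: sum.reindex)
    moreover have "x (n - 1) \<in> G n" for n
      using x by (metis diff_add_cancel suspension_def)
    ultimately have "component v (n + 1) =
        (if n + 1 \<in> (\<lambda>n. n + 1) ` {n. x n \<noteq> 0} then x (n + 1 - 1) else 0)"
      using x by (intro component_eqI) simp_all
    then show "x n = component v (n + 1)" by (auto simp: image_iff)
  qed
  ultimately show "\<exists>!x. ?P x" by (rule ex1I)
qed

end

lemma graded_vector_space_prod:
  fixes s :: "'k::field \<Rightarrow> 'v::ab_group_add \<Rightarrow> 'v" and t :: "'k \<Rightarrow> 'w::ab_group_add \<Rightarrow> 'w"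
  assumes "graded_vector_space s G" and "graded_vector_space t H"
  shows "graded_vector_space (module_prod.scale s t) (sum_grading G H)"
proof -
  interpret G: graded_vector_space s G by fact
  interpret H: graded_vector_space t H by fact
  interpret vector_space_prod s t ..
  show ?thesis
  proof
    show "p.subspace (sum_grading G H n)" for n
      unfolding sum_grading_def by (intro subspace_Times G.subspace_component H.subspace_component)
    fix vw :: "'v \<times> 'w"
    obtain v w where vw: "vw = (v, w)" by fastforce
    let ?P = "\<lambda>x. (\<forall>n. x n \<in> sum_grading G H n) \<and> finite {n. x n \<noteq> 0} \<and> vw = (\<Sum>n | x n \<noteq> 0. x n)"
    let ?x = "\<lambda>n. (G.component v n, H.component w n)"
    have supp: "{n. ?x n \<noteq> 0} = {n. G.component v n \<noteq> 0} \<union> {n. H.component w n \<noteq> 0}"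
      by (auto simp: zero_prod_def)
    have "(\<Sum>n | ?x n \<noteq> 0. ?x n) = vw"
      unfolding supp vw
      by (rule prod_eqI) (simp_all add: fst_sum snd_sum G.sum_component_superset H.sum_component_superset
        G.finite_component H.finite_component)
    then have "?P ?x"
      unfolding supp
      by (simp add: sum_grading_def G.component_mem H.component_mem G.finite_component H.finite_component)
    moreover have "x = ?x" if x: "?P x" for x
    proof
      fix n
      have "v = (\<Sum>n | x n \<noteq> 0. fst (x n))" "w = (\<Sum>n | x n \<noteq> 0. snd (x n))"
        using x vw by (metis fst_conv fst_sum, metis snd_conv snd_sum)
      moreover have "fst (x n) \<in> G n" "snd (x n) \<in> H n" for n
        using x by (auto simp: sum_grading_def mem_Times_iff)
      ultimately have "G.component v n = (if n \<in> {n. x n \<noteq> 0} then fst (x n) else 0)"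
        "H.component w n = (if n \<in> {n. x n \<noteq> 0} then snd (x n) else 0)"
        using x by (intro G.component_eqI H.component_eqI; simp)+
      then show "x n = ?x n"
        by (auto simp: prod_eq_iff)
    qed
    ultimately show "\<exists>!x. ?P x" by (rule ex1I)
  qed
qed

locale graded_linear_map = G: graded_vector_space s G + H: graded_vector_space t H
  for s :: "'k::field \<Rightarrow> 'v::ab_group_add \<Rightarrow> 'v" and G
    and t :: "'k::field \<Rightarrow> 'w::ab_group_add \<Rightarrow> 'w" and H +
  fixes h
  assumes graded_linear: "graded_linear s G t H h"
begin

sublocale linear: Vector_Spaces.linear s t h
  using graded_linear by (simp add: graded_linear_def)

lemma additive: "additive h"
  by standard (rule linear.add)

lemma map_mem: "x \<in> G n \<Longrightarrow> h x \<in> H n"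
  using graded_linear by (auto simp: graded_linear_def)

lemma component_map: "H.component (h v) n = h (G.component v n)"
proof -
  have "h v = (\<Sum>n | G.component v n \<noteq> 0. h (G.component v n))"
    by (subst G.sum_component[of v, symmetric]) (rule linear.sum)
  then have "H.component (h v) n = (if n \<in> {n. G.component v n \<noteq> 0} then h (G.component v n) else 0)"
    by (intro H.component_eqI) (simp_all add: G.finite_component map_mem G.component_mem)
  then show ?thesis by auto
qed

text \<open>Since \<open>h\<close> commutes with taking components, injectivity forces
  \<open>x\<close> to equal its component of degree \<open>n\<close> once \<open>h x\<close> has
  that degree. This provides the equivalence of gradings that \<open>restrict\<close> asks
  for.\<close>

lemma map_mem_iff:
  assumes "inj h"
  shows "h x \<in> H n \<longleftrightarrow> x \<in> G n"
proof
  assume "h x \<in> H n"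
  then have "h (G.component x n) = h x"
    using H.component_homogeneous[of "h x" n n] by (simp add: component_map)
  then have "G.component x n = x"
    using assms by (simp add: inj_eq)
  then show "x \<in> G n"
    using G.component_mem[of x n] by simp
qed (rule map_mem)

lemma parity_map: "H.parity (h v) = h (G.parity v)"
proof -
  have "additive (\<lambda>v. H.parity (h v))" "additive (\<lambda>v. h (G.parity v))"
    by (standard; simp add: linear.add H.parity_add G.parity_add)+
  then show ?thesis
    by (rule G.additive_eqI)
      (simp add: H.parity_homogeneous[OF map_mem] G.parity_homogeneous sg_hom[OF additive])
qed

end

section \<open>The graded Lie algebra with its commuting right actions\<close>

context graded_lie_algebra
begin

lemma additive_left: "additive (\<lambda>x. br x y)"
  using linear_left[of y] by (intro additive.intro) (simp add: Vector_Spaces.linear_iff)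

lemma additive_right: "additive (br x)"
  using linear_right[of x] by (intro additive.intro) (simp add: Vector_Spaces.linear_iff)

lemma br_scale: "br (scale c x) y = scale c (br x y)" "br x (scale c y) = scale c (br x y)"
  using linear_left[of y] linear_right[of x] by (simp_all add: Vector_Spaces.linear_iff)

lemmas br_add = additive.add[OF additive_left] additive.add[OF additive_right]
lemmas br_diff = additive.diff[OF additive_left] additive.diff[OF additive_right]
lemmas br_minus = additive.minus[OF additive_left] additive.minus[OF additive_right]
lemmas br_zero [simp] = additive.zero[OF additive_left] additive.zero[OF additive_right]
lemmas br_sg = sg_hom[OF additive_left] sg_hom[OF additive_right]

lemma br_swap: "x \<in> G m \<Longrightarrow> y \<in> G n \<Longrightarrow> br x y = - sg (m * n) (br y x)"
  using antisymmetry[of x m y n] by (simp add: scale_powi_minus_1)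

lemma br_left: "x \<in> G m \<Longrightarrow> y \<in> G n \<Longrightarrow> z \<in> G p \<Longrightarrow>
    br x (br y z) = br (br x y) z + sg (m * n) (br y (br x z))"
  using jacobi[of x m y n z p] by (simp add: scale_powi_minus_1)

text \<open>The Jacobi identity with \<open>br _ z\<close> as a derivation from the right, the form
  suited to iterated brackets with elements of \<open>A\<close> on the right.\<close>

lemma br_right:
  assumes "x \<in> G m" "y \<in> G n" "z \<in> G p"
  shows "br (br x y) z = br x (br y z) + sg (n * p) (br (br x z) y)"
proof -
  have "br y (br x z) = - sg (n * (m + p)) (br (br x z) y)"
    using assms by (intro br_swap bracket_degree)
  then show ?thesis
    using br_left[OF assms] by (simp add: sg_def)
qed

end

context generalised_V_datum
begin

sublocale \<iota>A: graded_linear_map sA GA sL GL \<iota>A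
  using iotaA_hom by unfold_locales (simp add: graded_lie_hom_def)

sublocale P: graded_linear_map sL GL sA GA P
  using P_linear by unfold_locales

abbreviation act :: "'l \<Rightarrow> 'a \<Rightarrow> 'l" where
  "act h \<xi> \<equiv> brL h (\<iota>A \<xi>)"

lemma iotaA_commute: "brL (\<iota>A \<xi>) (\<iota>A \<eta>) = 0"
  using iotaA_hom A_abelian by (metis graded_lie_hom_def \<iota>A.linear.zero)

text \<open>In the Jacobi identity the term with the bracket of two elements of \<open>A\<close>
  drops out, as \<open>A\<close> is abelian.\<close>

lemma act_commute:
  assumes "h \<in> GL D" "\<xi> \<in> GA d" "\<eta> \<in> GA e"
  shows "act (act h \<xi>) \<eta> = sg (d * e) (act (act h \<eta>) \<xi>)"
  using L.br_right[OF assms(1) \<iota>A.map_mem[OF assms(2)] \<iota>A.map_mem[OF assms(3)]]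
  by (simp add: iotaA_commute)

abbreviation homogeneous :: "(('l \<times> 'a) \<times> int) list \<Rightarrow> bool" where
  "homogeneous ps \<equiv> \<forall>p\<in>set ps. fst p \<in> sum_grading (suspension GL) GA (snd p)"

lemma homogeneous_pair:
  "(f, \<xi>) \<in> sum_grading (suspension GL) GA d \<longleftrightarrow> f \<in> GL (d + 1) \<and> \<xi> \<in> GA d"
  by (simp add: sum_grading_def suspension_def)

abbreviation acts :: "'l \<Rightarrow> 'a list \<Rightarrow> 'l" where
  "acts \<equiv> foldl act"

lemma additive_acts: "additive (\<lambda>h. acts h \<xi>s)"
proof
  show "acts (x + y) \<xi>s = acts x \<xi>s + acts y \<xi>s" for x y
    by (induction \<xi>s arbitrary: x y) (simp_all add: L.br_add)
qed

lemmas acts_add = additive.add[OF additive_acts]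
lemmas acts_minus = additive.minus[OF additive_acts]
lemmas acts_zero [simp] = additive.zero[OF additive_acts]
lemmas acts_sg = sg_hom[OF additive_acts]

lemma acts_scale: "acts (sL c h) \<xi>s = sL c (acts h \<xi>s)"
  by (induction \<xi>s arbitrary: h) (simp_all add: L.br_scale)

abbreviation acts' :: "'l \<Rightarrow> (('l \<times> 'a) \<times> int) list \<Rightarrow> 'l" where
  "acts' h ps \<equiv> acts h (map (snd \<circ> fst) ps)"

lemma acts_mem: "h \<in> GL D \<Longrightarrow> homogeneous ps \<Longrightarrow> acts' h ps \<in> GL (D + deg ps)"
proof (induction ps arbitrary: h D)
  case (Cons p ps)
  obtain f \<xi> d where p: "p = ((f, \<xi>), d)" by (metis surj_pair)
  have "act h \<xi> \<in> GL (D + d)"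
    using Cons.prems by (intro L.bracket_degree \<iota>A.map_mem) (simp_all add: p homogeneous_pair)
  from Cons.IH[OF this] Cons.prems show ?case
    by (simp add: p add.assoc)
qed simp

lemma act_acts:
  "h \<in> GL D \<Longrightarrow> \<xi> \<in> GA d \<Longrightarrow> homogeneous ps \<Longrightarrow> act (acts' h ps) \<xi> = sg (d * deg ps) (acts' (act h \<xi>) ps)"
proof (induction ps arbitrary: h D)
  case (Cons p ps)
  obtain g \<eta> e where p: "p = ((g, \<eta>), e)" by (metis surj_pair)
  have \<eta>: "\<eta> \<in> GA e" "homogeneous ps"
    using Cons.prems by (simp_all add: p homogeneous_pair)
  have "act (acts' (act h \<eta>) ps) \<xi> = sg (d * deg ps) (acts' (act (act h \<eta>) \<xi>) ps)"
    using Cons.prems \<eta> by (intro Cons.IH[of _ "D + e"] L.bracket_degree \<iota>A.map_mem)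
  also have "act (act h \<eta>) \<xi> = sg (e * d) (act (act h \<xi>) \<eta>)"
    using Cons.prems \<eta> by (intro act_commute)
  finally show ?case
    by (simp add: p acts_sg algebra_simps)
qed simp

text \<open>Pulling \<open>\<xi>\<close> past \<open>ps\<close> and turning the right bracket into a
  left one both contribute \<open>d * deg ps\<close> to the sign; these cancel and only the degree
  \<open>D\<close> of \<open>h\<close> remains. This trades right actions for the left actions that
  occur in \<open>word\<close>.\<close>

lemma acts_act:
  assumes "h \<in> GL D" "\<xi> \<in> GA d" "homogeneous ps"
  shows "acts' (act h \<xi>) ps = - sg (d * D) (brL (\<iota>A \<xi>) (acts' h ps))"
proof -
  have "brL (\<iota>A \<xi>) (acts' h ps) = - sg (d * (D + deg ps)) (act (acts' h ps) \<xi>)"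
    using assms by (intro L.br_swap \<iota>A.map_mem acts_mem)
  then show ?thesis
    using act_acts[OF assms] by (simp add: sg_def)
qed

section \<open>The operations without the Maurer-Cartan element\<close>

text \<open>The \<open>A\<close>-component of \<open>l(x\<^sub>1, \<dots>, x\<^sub>n)\<close> is \<open>P (word [x\<^sub>1, \<dots>, x\<^sub>n])\<close>: moving the suspended
  element \<open>s f\<^sub>k\<close> to the front past \<open>\<xi>\<^sub>1, \<dots>, \<xi>\<^bsub>k-1\<^esub>\<close> turns the right action of \<open>\<xi>\<^sub>i\<close> into the
  left action of \<open>- (- 1)\<^bsup>|\<xi>\<^sub>i|\<^esup> \<xi>\<^sub>i\<close>.\<close>

primrec word :: "('l \<times> 'a) list \<Rightarrow> 'l" where
  "word [] = 0"
| "word (x # xs) = acts (fst x) (map snd xs) - brL (L.parity (\<iota>A (snd x))) (word xs)"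

abbreviation word' :: "(('l \<times> 'a) \<times> int) list \<Rightarrow> 'l" where
  "word' ps \<equiv> word (map fst ps)"

lemma word'_Cons:
  "\<xi> \<in> GA d \<Longrightarrow> word' (((f, \<xi>), d) # ps) = acts' f ps - sg d (brL (\<iota>A \<xi>) (word' ps))"
  by (simp add: L.parity_homogeneous[OF \<iota>A.map_mem] L.br_sg)

declare word.simps(2) [simp del]

lemma word_mem: "homogeneous ps \<Longrightarrow> word' ps \<in> GL (deg ps + 1)"
proof (induction ps)
  case (Cons p ps)
  obtain f \<xi> d where p: "p = ((f, \<xi>), d)" by (metis surj_pair)
  have hom: "f \<in> GL (d + 1)" "\<xi> \<in> GA d" "homogeneous ps"
    using Cons.prems by (simp_all add: p homogeneous_pair)
  have "brL (\<iota>A \<xi>) (word' ps) \<in> GL (d + (deg ps + 1))"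
    using hom by (intro L.bracket_degree \<iota>A.map_mem Cons.IH)
  moreover have "acts' f ps \<in> GL (d + 1 + deg ps)"
    using hom by (intro acts_mem)
  ultimately have "word' (p # ps) \<in> GL (d + (deg ps + 1))"
    unfolding p word'_Cons[OF hom(2)]
    by (intro L.diff_mem L.sg_mem) (simp_all add: add.assoc add.commute add.left_commute)
  then show ?case by (simp add: p add.assoc)
qed (simp add: L.zero_mem)

text \<open>The coefficient form of
  \<open>[exp(ad \<xi>) f, exp(ad \<xi>) g] = exp(ad \<xi>) [f, g]\<close>: each
  \<open>\<xi>\<close> acts as a derivation of the bracket. The sign is that of exchanging
  \<open>g\<close> with \<open>u\<close>.\<close>

lemma unshuffle_acts_acts:
  assumes "f \<in> GL D" "g \<in> GL E" "homogeneous ps"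
  shows "unshuffle_sum ps (\<lambda>u v. sg (E * deg u) (brL (acts' f u) (acts' g v))) = acts' (brL f g) ps"
  using assms
proof (induction ps arbitrary: f g D E)
  case (Cons p ps)
  obtain h \<eta> e where p: "p = ((h, \<eta>), e)" by (metis surj_pair)
  have \<eta>: "\<eta> \<in> GA e" "\<iota>A \<eta> \<in> GL e" "homogeneous ps"
    using Cons.prems by (simp_all add: p homogeneous_pair \<iota>A.map_mem)
  have "unshuffle_sum ps (\<lambda>u v. sg (E * deg (p # u)) (brL (acts' f (p # u)) (acts' g v))) =
      unshuffle_sum ps (\<lambda>u v. sg (E * e) (sg (E * deg u) (brL (acts' (act f \<eta>) u) (acts' g v))))"
    by (simp add: p algebra_simps)
  also have "\<dots> = sg (E * e) (acts' (brL (act f \<eta>) g) ps)"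
    unfolding unshuffle_sum_sg using Cons.prems \<eta>
    by (subst Cons.IH[of _ "D + e"]) (simp_all add: L.bracket_degree)
  finally have A: "unshuffle_sum ps (\<lambda>u v. sg (E * deg (p # u)) (brL (acts' f (p # u)) (acts' g v))) =
      sg (E * e) (acts' (brL (act f \<eta>) g) ps)" .
  have "unshuffle_sum ps (\<lambda>u v. sg (snd p * deg u) (sg (E * deg u) (brL (acts' f u) (acts' g (p # v))))) =
      unshuffle_sum ps (\<lambda>u v. sg ((E + e) * deg u) (brL (acts' f u) (acts' (act g \<eta>) v)))"
    by (simp add: p algebra_simps)
  also have "\<dots> = acts' (brL f (act g \<eta>)) ps"
    using Cons.prems \<eta> by (subst Cons.IH[of _ D]) (simp_all add: L.bracket_degree)
  finally have B: "unshuffle_sum ps (\<lambda>u v. sg (snd p * deg u) (sg (E * deg u) (brL (acts' f u) (acts' g (p # v))))) =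
      acts' (brL f (act g \<eta>)) ps" .
  have "act (brL f g) \<eta> = brL f (act g \<eta>) + sg (E * e) (brL (act f \<eta>) g)"
    using Cons.prems \<eta> by (intro L.br_right)
  then show ?case
    using A B by (simp add: p acts_add acts_sg comp_def)
qed simp

text \<open>If the head contributes \<open>g\<close>, the Leibniz rule
  \<open>unshuffle_acts_acts\<close> collapses the sum. If it contributes \<open>\<eta>\<close>,
  this acts either on \<open>f\<close> or on the word, and the two terms combine by the Jacobi
  identity into one bracket with \<open>\<eta>\<close> outside the sum.\<close>

lemma unshuffle_acts_word_Cons:
  assumes f: "f \<in> GL D" and hom: "homogeneous (((g, \<eta>), e) # ps)"
  defines "Y \<equiv> \<lambda>ps. unshuffle_sum ps (\<lambda>u v. sg (deg u) (brL (acts' f u) (word' v)))"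
  shows "Y (((g, \<eta>), e) # ps) = acts' (brL f g) ps - sg (e + e * D) (brL (\<iota>A \<eta>) (Y ps))"
proof -
  let ?p = "((g, \<eta>), e)"
  have g: "g \<in> GL (e + 1)" "\<eta> \<in> GA e" "\<iota>A \<eta> \<in> GL e" "homogeneous ps"
    using hom by (simp_all add: homogeneous_pair \<iota>A.map_mem)
  have "Y (?p # ps) = unshuffle_sum ps (\<lambda>u v.
      sg ((e + 1) * deg u) (brL (acts' f u) (acts' g v)) -
      sg (e + e * D) (brL (\<iota>A \<eta>) (sg (deg u) (brL (acts' f u) (word' v)))))"
    unfolding Y_def unshuffle_sum.simps unshuffle_sum_add[symmetric]
  proof (rule unshuffle_sum_cong)
    fix u v assume uv: "set u \<union> set v = set ps"
    then have u: "homogeneous u" and v: "homogeneous v" using g(4) by blast+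
    let ?T = "acts' f u" and ?T' = "acts' (act f \<eta>) u" and ?W = "word' v"
    have T: "?T \<in> GL (D + deg u)" and W: "?W \<in> GL (deg v + 1)"
      using f u v by (simp_all add: acts_mem word_mem)
    have "?T' = - sg (e * D) (brL (\<iota>A \<eta>) ?T)"
      using f g u by (intro acts_act)
    then have "brL ?T' ?W = - sg (e * D) (brL (brL (\<iota>A \<eta>) ?T) ?W)"
      by (simp add: L.br_minus L.br_sg)
    moreover have "brL (\<iota>A \<eta>) (brL ?T ?W) = brL (brL (\<iota>A \<eta>) ?T) ?W + sg (e * (D + deg u)) (brL ?T (brL (\<iota>A \<eta>) ?W))"
      using g T W by (intro L.br_left)
    ultimately have "brL ?T (brL (\<iota>A \<eta>) ?W) =
        sg (e * D + e * deg u) (brL (\<iota>A \<eta>) (brL ?T ?W)) + sg (e * deg u) (brL ?T' ?W)"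
      by (simp add: sg_def algebra_simps)
    then show "sg (deg (?p # u)) (brL (acts' f (?p # u)) ?W) +
        sg (snd ?p * deg u) (sg (deg u) (brL ?T (word' (?p # v)))) =
        sg ((e + 1) * deg u) (brL ?T (acts' g v)) -
        sg (e + e * D) (brL (\<iota>A \<eta>) (sg (deg u) (brL ?T ?W)))"
      unfolding word'_Cons[OF g(2)]
      by (simp add: L.br_diff L.br_sg sg_diff sg_add) (simp add: sg_def)
  qed
  also have "\<dots> = unshuffle_sum ps (\<lambda>u v. sg ((e + 1) * deg u) (brL (acts' f u) (acts' g v))) -
      sg (e + e * D) (brL (\<iota>A \<eta>) (Y ps))"
    unfolding Y_def diff_conv_add_uminus
    by (simp add: unshuffle_sum_add unshuffle_sum_minus unshuffle_sum_sg unshuffle_sum_hom[OF L.additive_right]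
      del: add_uminus_conv_diff)
  also have "unshuffle_sum ps (\<lambda>u v. sg ((e + 1) * deg u) (brL (acts' f u) (acts' g v))) = acts' (brL f g) ps"
    using f g by (intro unshuffle_acts_acts)
  finally show ?thesis .
qed

text \<open>The right-hand side of \<open>unshuffle_acts_word\<close> obeys the same recursion as
  the left: either the head is the chosen entry, or its \<open>\<eta>\<close> acts on the bracket
  and is brought to the left by \<open>acts_act\<close>.\<close>

lemma unshuffle_single_Cons:
  assumes f: "f \<in> GL D" and hom: "homogeneous (((g, \<eta>), e) # ps)"
  defines "Z \<equiv> \<lambda>ps. unshuffle_sum ps (\<lambda>u v. if length u = 1 then acts' (brL f (fst (fst (hd u)))) v else 0)"
  shows "Z (((g, \<eta>), e) # ps) = acts' (brL f g) ps - sg (e + e * D) (brL (\<iota>A \<eta>) (Z ps))"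
proof -
  let ?p = "((g, \<eta>), e)"
  have g: "g \<in> GL (e + 1)" "\<eta> \<in> GA e" "\<iota>A \<eta> \<in> GL e" "homogeneous ps"
    using hom by (simp_all add: homogeneous_pair \<iota>A.map_mem)
  have "unshuffle_sum ps (\<lambda>u v. if length (?p # u) = 1 then acts' (brL f (fst (fst (hd (?p # u))))) v else 0) =
      acts' (brL f g) ps"
    by (simp add: unshuffle_sum_Nil_left cong: if_cong)
  moreover have "unshuffle_sum ps (\<lambda>u v. sg (snd ?p * deg u)
        (if length u = 1 then acts' (brL f (fst (fst (hd u)))) (?p # v) else 0)) =
      unshuffle_sum ps (\<lambda>u v. - sg (e + e * D) (brL (\<iota>A \<eta>)
        (if length u = 1 then acts' (brL f (fst (fst (hd u)))) v else 0)))"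
  proof (rule unshuffle_sum_cong)
    fix u v assume "set u \<union> set v = set ps"
    then have u: "homogeneous u" and v: "homogeneous v" using g(4) by blast+
    show "sg (snd ?p * deg u) (if length u = 1 then acts' (brL f (fst (fst (hd u)))) (?p # v) else 0) =
      - sg (e + e * D) (brL (\<iota>A \<eta>) (if length u = 1 then acts' (brL f (fst (fst (hd u)))) v else 0))"
    proof (cases "length u = 1")
      case True
      then obtain h \<zeta> c where u_eq: "u = [((h, \<zeta>), c)]"
        by (auto simp: length_Suc_conv)
      have "brL f h \<in> GL (D + (c + 1))"
        using f u by (intro L.bracket_degree) (simp_all add: u_eq homogeneous_pair)
      from acts_act[OF this g(2) v] show ?thesis
        by (simp add: u_eq sg_def)
    qed simp
  qed
  ultimately show ?thesis
    unfolding Z_def unshuffle_sum.simps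
    by (simp add: unshuffle_sum_minus unshuffle_sum_sg unshuffle_sum_hom[OF L.additive_right])
qed

text \<open>The same exponential identity with \<open>g\<close> ranging over the
  \<open>L\<close>-components of \<open>ps\<close>; a splitting with \<open>length u = 1\<close>
  selects one of them. Both sides satisfy one recursion.\<close>

lemma unshuffle_acts_word:
  assumes "f \<in> GL D" "homogeneous ps"
  shows "unshuffle_sum ps (\<lambda>u v. sg (deg u) (brL (acts' f u) (word' v))) =
    unshuffle_sum ps (\<lambda>u v. if length u = 1 then acts' (brL f (fst (fst (hd u)))) v else 0)"
  using assms(2)
proof (induction ps)
  case (Cons p ps)
  obtain g \<eta> e where p: "p = ((g, \<eta>), e)" by (metis surj_pair)
  have hom: "homogeneous (((g, \<eta>), e) # ps)" and hom': "homogeneous ps"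
    using Cons.prems by (simp_all add: p)
  show ?case
    unfolding p unshuffle_acts_word_Cons[OF assms(1) hom] unshuffle_single_Cons[OF assms(1) hom]
      Cons.IH[OF hom'] ..
qed simp

text \<open>The \<open>L\<close>-component of the operations; \<open>L.parity\<close> supplies the
  sign \<open>(- 1)^|f|\<close> of \<open>l_2(sf, sg)\<close>.\<close>

definition pair_bracket :: "('l \<times> 'a) list \<Rightarrow> 'l" where
  "pair_bracket xs = (if length xs = 2 then brL (L.parity (fst (xs ! 0))) (fst (xs ! 1)) else 0)"

text \<open>Suspension shifts degrees: \<open>f\<close> has degree \<open>d + 1\<close> in
  \<open>L\<close>, whence the minus sign in front of \<open>sg d\<close>.\<close>

lemma pair_bracket_Cons:
  "f \<in> GL (d + 1) \<Longrightarrow> pair_bracket (map fst (((f, \<xi>), d) # u)) =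
    (if length u = 1 then - sg d (brL f (fst (fst (hd u)))) else 0)"
  by (auto simp: pair_bracket_def L.parity_homogeneous L.br_sg length_Suc_conv sg_def L.br_minus)

lemma pair_bracket_mem:
  assumes "homogeneous u"
  shows "pair_bracket (map fst u) \<in> GL (deg u + 2)"
proof (cases u)
  case (Cons p u')
  obtain f \<xi> d where p: "p = ((f, \<xi>), d)" by (metis surj_pair)
  have f: "f \<in> GL (d + 1)" using assms by (simp add: Cons p homogeneous_pair)
  show ?thesis
  proof (cases "length u' = 1")
    case True
    then obtain h \<zeta> c where u_eq: "u' = [((h, \<zeta>), c)]"
      by (auto simp: length_Suc_conv)
    have "brL f h \<in> GL ((d + 1) + (c + 1))"
      using f assms by (intro L.bracket_degree) (simp_all add: Cons u_eq homogeneous_pair)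
    then have "sg (d + 1) (brL f h) \<in> GL (d + c + 2)"
      by (intro L.sg_mem) (simp add: algebra_simps)
    then have "- sg d (brL f h) \<in> GL (d + c + 2)"
      by (simp add: sg_def split: if_splits)
    then show ?thesis
      by (simp only: Cons p pair_bracket_Cons[OF f]) (simp add: u_eq)
  qed (simp only: Cons p pair_bracket_Cons[OF f] if_False L.zero_mem)
qed (simp add: pair_bracket_def L.zero_mem)

text \<open>The letter \<open>f\<close> enters the left or the right word. A word has degree one
  above the total degree of its entries, so the bracket of two words, weighted by
  \<open>sg (deg u)\<close>, is symmetric under exchange of \<open>u\<close> and \<open>v\<close>,
  and both contributions equal \<open>sg d Y\<close>. The terms with \<open>\<xi>\<close> combine by
  the Jacobi identity.\<close>

lemma unshuffle_word_word_Cons: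
  assumes hom: "homogeneous (((f, \<xi>), d) # ps)"
  defines "V \<equiv> \<lambda>ps. unshuffle_sum ps (\<lambda>u v. sg (deg u) (brL (word' u) (word' v)))"
  defines "Y \<equiv> unshuffle_sum ps (\<lambda>u v. sg (deg u) (brL (acts' f u) (word' v)))"
  shows "V (((f, \<xi>), d) # ps) = sg d Y + sg d Y - brL (\<iota>A \<xi>) (V ps)"
proof -
  let ?p = "((f, \<xi>), d)"
  have f: "f \<in> GL (d + 1)" "\<xi> \<in> GA d" "\<iota>A \<xi> \<in> GL d" "homogeneous ps"
    using hom by (simp_all add: homogeneous_pair \<iota>A.map_mem)
  have mem: "word' u \<in> GL (deg u + 1)" "acts' f u \<in> GL (d + 1 + deg u)"
    "word' v \<in> GL (deg v + 1)" "acts' f v \<in> GL (d + 1 + deg v)"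
    if "set u \<union> set v = set ps" for u v :: "(('l \<times> 'a) \<times> int) list"
    using that f by (auto intro!: word_mem acts_mem)
  have "V (?p # ps) = unshuffle_sum ps (\<lambda>u v.
      sg d (sg (deg u) (brL (acts' f u) (word' v))) +
      sg ((d + 1) * deg u) (brL (word' u) (acts' f v)) +
      - brL (\<iota>A \<xi>) (sg (deg u) (brL (word' u) (word' v))))"
    unfolding V_def unshuffle_sum.simps unshuffle_sum_add[symmetric]
  proof (rule unshuffle_sum_cong)
    fix u v assume uv: "set u \<union> set v = set ps"
    note mem = mem[OF uv]
    have "brL (\<iota>A \<xi>) (brL (word' u) (word' v)) =
        brL (brL (\<iota>A \<xi>) (word' u)) (word' v) + sg (d * (deg u + 1)) (brL (word' u) (brL (\<iota>A \<xi>) (word' v)))"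
      using f mem by (intro L.br_left)
    then show "sg (deg (?p # u)) (brL (word' (?p # u)) (word' v)) +
        sg (snd ?p * deg u) (sg (deg u) (brL (word' u) (word' (?p # v)))) =
      sg d (sg (deg u) (brL (acts' f u) (word' v))) +
      sg ((d + 1) * deg u) (brL (word' u) (acts' f v)) +
      - brL (\<iota>A \<xi>) (sg (deg u) (brL (word' u) (word' v)))"
      unfolding word'_Cons[OF f(2)]
      by (simp add: L.br_diff L.br_sg sg_diff sg_add) (simp add: sg_def algebra_simps)
  qed
  also have "\<dots> = sg d Y + unshuffle_sum ps (\<lambda>u v. sg ((d + 1) * deg u) (brL (word' u) (acts' f v))) +
      - brL (\<iota>A \<xi>) (V ps)"
    unfolding V_def Y_def
    by (simp only: unshuffle_sum_add unshuffle_sum_minus unshuffle_sum_hom[OF L.additive_right]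
      unshuffle_sum_hom[OF additive_sg])
  also have "unshuffle_sum ps (\<lambda>u v. sg ((d + 1) * deg u) (brL (word' u) (acts' f v))) = sg d Y"
    unfolding Y_def unshuffle_sum_sg[symmetric]
  proof (subst unshuffle_sum_swap, rule unshuffle_sum_cong)
    fix u v assume uv: "set u \<union> set v = set ps"
    note mem = mem[OF uv]
    have "brL (word' v) (acts' f u) = - sg ((deg v + 1) * (d + 1 + deg u)) (brL (acts' f u) (word' v))"
      using mem by (intro L.br_swap)
    then show "sg (deg u * deg v) (sg ((d + 1) * deg v) (brL (word' v) (acts' f u))) =
        sg d (sg (deg u) (brL (acts' f u) (word' v)))"
      by (simp add: sg_def)
  qed
  finally show ?thesis by simp
qed

text \<open>The recursion of \<open>unshuffle_word_word_Cons\<close> with \<open>- 1\<close> in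
  place of 2 in its inhomogeneous term, which is why the two sums differ by the factor
  \<open>- 2\<close>.\<close>

lemma unshuffle_pair_Cons:
  assumes hom: "homogeneous (((f, \<xi>), d) # ps)"
  defines "U \<equiv> \<lambda>ps. unshuffle_sum ps (\<lambda>u v. acts' (pair_bracket (map fst u)) v)"
  defines "Z \<equiv> unshuffle_sum ps (\<lambda>u v. if length u = 1 then acts' (brL f (fst (fst (hd u)))) v else 0)"
  shows "U (((f, \<xi>), d) # ps) = - sg d Z - brL (\<iota>A \<xi>) (U ps)"
proof -
  let ?p = "((f, \<xi>), d)"
  have f: "f \<in> GL (d + 1)" "\<xi> \<in> GA d" "homogeneous ps"
    using hom by (simp_all add: homogeneous_pair)
  have "unshuffle_sum ps (\<lambda>u v. acts' (pair_bracket (map fst (?p # u))) v) = - sg d Z"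
    unfolding Z_def unshuffle_sum_sg[symmetric] unshuffle_sum_minus[symmetric] pair_bracket_Cons[OF f(1)]
    by (rule unshuffle_sum_cong) (simp add: acts_minus acts_sg)
  moreover have "unshuffle_sum ps (\<lambda>u v. sg (snd ?p * deg u) (acts' (pair_bracket (map fst u)) (?p # v))) =
      - brL (\<iota>A \<xi>) (U ps)"
    unfolding U_def unshuffle_sum_hom[OF L.additive_right, symmetric] unshuffle_sum_minus[symmetric]
  proof (rule unshuffle_sum_cong)
    fix u v assume "set u \<union> set v = set ps"
    then have u: "homogeneous u" and v: "homogeneous v" using f by blast+
    from acts_act[OF pair_bracket_mem[OF u] f(2) v]
    show "sg (snd ?p * deg u) (acts' (pair_bracket (map fst u)) (?p # v)) =
      - brL (\<iota>A \<xi>) (acts' (pair_bracket (map fst u)) v)"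
      by (simp add: sg_def)
  qed
  ultimately show ?thesis
    unfolding U_def unshuffle_sum.simps by simp
qed

text \<open>The sum \<open>U\<close> meets each pair of entries once, whereas \<open>[f, f]\<close>
  contains it twice; the minus sign stems from the degree shift in
  \<open>pair_bracket_Cons\<close>.\<close>

lemma unshuffle_word_word:
  assumes "homogeneous ps"
  defines "U \<equiv> unshuffle_sum ps (\<lambda>u v. acts' (pair_bracket (map fst u)) v)"
  shows "unshuffle_sum ps (\<lambda>u v. sg (deg u) (brL (word' u) (word' v))) = - (U + U)"
  using assms(1) unfolding U_def
proof (induction ps)
  case Nil
  show ?case by (simp add: pair_bracket_def)
next
  case (Cons p ps)
  obtain f \<xi> d where p: "p = ((f, \<xi>), d)" by (metis surj_pair)
  have f: "f \<in> GL (d + 1)" "homogeneous ps"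
    using Cons.prems by (simp_all add: p homogeneous_pair)
  show ?case
    using Cons.prems Cons.IH[OF f(2)] unfolding p
    by (simp only: unshuffle_word_word_Cons unshuffle_pair_Cons unshuffle_acts_word[OF f])
      (simp add: L.br_minus L.br_add L.br_diff comp_def algebra_simps)
qed

section \<open>Multilinearity and graded symmetry of the two components\<close>

lemma acts_slot_add: "acts h (us @ (\<xi> + \<eta>) # vs) = acts h (us @ \<xi> # vs) + acts h (us @ \<eta> # vs)"
  by (simp add: \<iota>A.linear.add L.br_add acts_add)

lemma acts_slot_scale: "acts h (us @ sA c \<xi> # vs) = sL c (acts h (us @ \<xi> # vs))"
  by (simp add: \<iota>A.linear.scale L.br_scale acts_scale)

lemma acts_eq_0: "0 \<in> set \<xi>s \<Longrightarrow> acts h \<xi>s = 0"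
  by (induction \<xi>s arbitrary: h) auto

lemma word_slot_add: "word (us @ (x + y) # vs) = word (us @ x # vs) + word (us @ y # vs)"
  by (induction us) (simp_all add: word.simps(2) acts_slot_add acts_add \<iota>A.linear.add L.parity_add L.br_add
      del: foldl_append)

lemma word_slot_scale:
  "word (us @ (sL c (fst x), sA c (snd x)) # vs) = sL c (word (us @ x # vs))"
  by (induction us) (simp_all add: word.simps(2) acts_slot_scale acts_scale \<iota>A.linear.scale L.parity_scale
      L.br_scale L.scale_right_diff_distrib del: foldl_append)

lemma pair_bracket_slot_add:
  "pair_bracket (us @ (x + y) # vs) = pair_bracket (us @ x # vs) + pair_bracket (us @ y # vs)"
  by (cases us; cases "tl us") (auto simp: pair_bracket_def L.parity_add L.br_add)

lemma pair_bracket_slot_scale: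
  "pair_bracket (us @ (sL c (fst x), \<xi>) # vs) = sL c (pair_bracket (us @ x # vs))"
  by (cases us; cases "tl us") (auto simp: pair_bracket_def L.parity_scale L.br_scale)

lemma acts_swap:
  assumes "h \<in> GL D" "homogeneous us" "\<xi> \<in> GA d" "\<eta> \<in> GA e"
  shows "acts h (map (snd \<circ> fst) us @ \<xi> # \<eta> # \<xi>s) = sg (d * e) (acts h (map (snd \<circ> fst) us @ \<eta> # \<xi> # \<xi>s))"
  using act_commute[OF acts_mem[OF assms(1,2)] assms(3,4)]
  by (simp add: acts_sg)

text \<open>Once the prefix is peeled off, two letters change places at the front. Where
  \<open>f\<close> is the \<open>L\<close>-letter, \<open>\<eta>\<close> acts from the right in one
  order and from the left in the other; \<open>acts_act\<close> reconciles the two, and likewise for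
  \<open>g\<close>. Two left actions commute up to the Koszul sign.\<close>

lemma word_swap:
  assumes "homogeneous (us @ p # q # vs)"
  shows "word' (us @ p # q # vs) = sg (snd p * snd q) (word' (us @ q # p # vs))"
  using assms
proof (induction us)
  case Nil
  obtain f \<xi> d where p: "p = ((f, \<xi>), d)" by (metis surj_pair)
  obtain g \<eta> e where q: "q = ((g, \<eta>), e)" by (metis surj_pair)
  have f: "f \<in> GL (d + 1)" "\<xi> \<in> GA d" "\<iota>A \<xi> \<in> GL d"
    and g: "g \<in> GL (e + 1)" "\<eta> \<in> GA e" "\<iota>A \<eta> \<in> GL e" and vs: "homogeneous vs"
    using Nil by (simp_all add: p q homogeneous_pair \<iota>A.map_mem)
  have "act (act f \<xi>) \<eta> = sg (d * e) (act (act f \<eta>) \<xi>)"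
    "act (act g \<xi>) \<eta> = sg (d * e) (act (act g \<eta>) \<xi>)"
    using f g by (auto intro: act_commute)
  moreover have "acts' (act g \<xi>) vs = - sg (d * (e + 1)) (brL (\<iota>A \<xi>) (acts' g vs))"
    "acts' (act f \<eta>) vs = - sg (e * (d + 1)) (brL (\<iota>A \<eta>) (acts' f vs))"
    using f g vs by (auto intro: acts_act)
  moreover have "brL (\<iota>A \<xi>) (brL (\<iota>A \<eta>) (word' vs)) = sg (d * e) (brL (\<iota>A \<eta>) (brL (\<iota>A \<xi>) (word' vs)))"
    using L.br_left[OF f(3) g(3) word_mem[OF vs]] by (simp add: iotaA_commute)
  ultimately show ?case
    unfolding p q append_Nil word'_Cons[OF f(2)] word'_Cons[OF g(2)]
    by (simp add: acts_sg L.br_diff L.br_sg sg_diff) (simp add: sg_def algebra_simps)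
next
  case (Cons r us)
  obtain h \<zeta> c where r: "r = ((h, \<zeta>), c)" by (metis surj_pair)
  obtain f \<xi> d where p: "p = ((f, \<xi>), d)" by (metis surj_pair)
  obtain g \<eta> e where q: "q = ((g, \<eta>), e)" by (metis surj_pair)
  have h: "h \<in> GL (c + 1)" "\<zeta> \<in> GA c" "\<xi> \<in> GA d" "\<eta> \<in> GA e" "homogeneous us"
    and IH: "word' (us @ p # q # vs) = sg (d * e) (word' (us @ q # p # vs))"
    using Cons by (simp_all add: p q r homogeneous_pair)
  have "acts' h (us @ p # q # vs) = sg (d * e) (acts' h (us @ q # p # vs))"
    using acts_swap[OF h(1,5,3,4)] by (simp add: p q del: foldl_append foldl_Cons)
  then show ?case
    unfolding r append_Cons word'_Cons[OF h(2)] IH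
    by (simp add: p q L.br_sg sg_diff algebra_simps)
qed

text \<open>The shift of degrees by one turns the graded antisymmetry of the bracket into graded
  symmetry.\<close>

lemma pair_bracket_swap:
  assumes "homogeneous (us @ p # q # vs)"
  shows "pair_bracket (map fst (us @ p # q # vs)) = sg (snd p * snd q) (pair_bracket (map fst (us @ q # p # vs)))"
proof (cases "us = [] \<and> vs = []")
  case True
  obtain f \<xi> d where p: "p = ((f, \<xi>), d)" by (metis surj_pair)
  obtain g \<eta> e where q: "q = ((g, \<eta>), e)" by (metis surj_pair)
  have f: "f \<in> GL (d + 1)" and g: "g \<in> GL (e + 1)"
    using assms by (simp_all add: p q homogeneous_pair)
  show ?thesis
    using L.br_swap[OF f g] True
    by (simp add: p q pair_bracket_def L.parity_homogeneous[OF f] L.parity_homogeneous[OF g] L.br_sg)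
      (simp add: sg_def L.br_minus)
qed (auto simp: pair_bracket_def)

section \<open>Jacobi identities of the operations without \<open>\<Delta>\<close>\<close>

lemma P_bracket: "P (brL a b) = P (brL (\<iota>A (P a)) b) + P (brL a (\<iota>A (P b)))"
proof -
  \<comment> \<open>As \<open>P\<close> splits \<open>\<iota>A\<close>, both factors lie in the
    kernel. On expanding their bracket, the term with two elements of \<open>A\<close> drops
    out.\<close>
  have "P (brL (a - \<iota>A (P a)) (b - \<iota>A (P b))) = 0"
    using kernel_subalgebra by (simp add: graded_lie_subalgebra_def P.linear.diff P_iotaA)
  then show ?thesis
    by (simp add: L.br_diff iotaA_commute P.linear.diff P.linear.add algebra_simps)
qed

lemma unshuffle_P_word:
  assumes two: "(2::'k) \<noteq> 0" and hom: "homogeneous ps"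
  shows "unshuffle_sum ps (\<lambda>u v. P (word ((pair_bracket (map fst u), P (word' u)) # map fst v))) = 0"
    (is "?J = 0")
proof -
  let ?U = "unshuffle_sum ps (\<lambda>u v. acts' (pair_bracket (map fst u)) v)"
  let ?C = "unshuffle_sum ps (\<lambda>u v. sg (deg u) (P (brL (\<iota>A (P (word' u))) (word' v))))"
  have mem: "word' u \<in> GL (deg u + 1)" "P (word' u) \<in> GA (deg u + 1)" "\<iota>A (P (word' u)) \<in> GL (deg u + 1)"
    if "set u \<union> set v = set ps \<or> set v \<union> set u = set ps" for u v :: "(('l \<times> 'a) \<times> int) list"
    using that hom word_mem[of u] by (auto intro!: P.map_mem \<iota>A.map_mem)
  \<comment> \<open>The inner value becomes the first letter of the outer word. Its
    \<open>L\<close>-component gives the first summand; its \<open>A\<close>-component, of degree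
    \<open>deg u + 1\<close>, gives the second, and the shift turns the minus sign of
    \<open>word'_Cons\<close> into a plus.\<close>
  have "?J = unshuffle_sum ps (\<lambda>u v. P (acts' (pair_bracket (map fst u)) v) +
      sg (deg u) (P (brL (\<iota>A (P (word' u))) (word' v))))"
  proof (rule unshuffle_sum_cong)
    fix u v assume "set u \<union> set v = set ps"
    then have *: "P (word' u) \<in> GA (deg u + 1)" using mem by blast
    show "P (word ((pair_bracket (map fst u), P (word' u)) # map fst v)) =
        P (acts' (pair_bracket (map fst u)) v) + sg (deg u) (P (brL (\<iota>A (P (word' u))) (word' v)))"
      using word'_Cons[OF *, of "pair_bracket (map fst u)" v]
      by (simp add: sg_def P.linear.diff P.linear.add P.linear.neg)
  qed
  then have J: "?J = P ?U + ?C"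
    by (simp add: unshuffle_sum_add unshuffle_sum_hom[OF P.additive] comp_def)
  \<comment> \<open>Exchanging \<open>u\<close> and \<open>v\<close> moves the projection to the
    other factor, so that \<open>?C + ?C\<close> consists of the two halves of
    \<open>P_bracket\<close>.\<close>
  have "?C = unshuffle_sum ps (\<lambda>u v. sg (deg u) (P (brL (word' u) (\<iota>A (P (word' v))))))"
  proof (subst unshuffle_sum_swap, rule unshuffle_sum_cong)
    fix u v assume "set u \<union> set v = set ps"
    then have "brL (\<iota>A (P (word' v))) (word' u) =
        - sg ((deg v + 1) * (deg u + 1)) (brL (word' u) (\<iota>A (P (word' v))))"
      using mem by (intro L.br_swap) blast+
    then show "sg (deg u * deg v) (sg (deg v) (P (brL (\<iota>A (P (word' v))) (word' u)))) =
        sg (deg u) (P (brL (word' u) (\<iota>A (P (word' v)))))"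
      by (simp add: sg_def P.linear.neg)
  qed
  then have "?C + ?C = unshuffle_sum ps (\<lambda>u v. sg (deg u) (P (brL (word' u) (word' v))))"
    unfolding P_bracket[of "word' _" "word' _"] sg_add unshuffle_sum_add by simp
  also have "\<dots> = P (unshuffle_sum ps (\<lambda>u v. sg (deg u) (brL (word' u) (word' v))))"
    by (simp add: sg_hom[OF P.additive] flip: unshuffle_sum_hom[OF P.additive])
  also have "\<dots> = - (P ?U + P ?U)"
    unfolding unshuffle_word_word[OF hom] by (simp add: P.linear.neg P.linear.add P.linear.diff)
  finally have "?J + ?J = 0"
    unfolding J by (simp add: algebra_simps)
  then show ?thesis
    by (rule A.double_eq_0[OF two])
qed

text \<open>The outer bracket needs one entry in \<open>v\<close> and the inner one two in
  \<open>u\<close>, so only lists of length 3 contribute, and there it is the Jacobi identity of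
  \<open>L\<close>.\<close>

lemma unshuffle_pair_bracket:
  assumes hom: "homogeneous ps"
  shows "unshuffle_sum ps (\<lambda>u v. pair_bracket ((pair_bracket (map fst u), h u) # map fst v)) = 0"
proof (cases "length ps = 3")
  case False
  have "unshuffle_sum ps (\<lambda>u v. pair_bracket ((pair_bracket (map fst u), h u) # map fst v)) =
      unshuffle_sum ps (\<lambda>u v. 0)"
  proof (rule unshuffle_sum_cong)
    fix u v :: "(('l \<times> 'a) \<times> int) list" assume len: "length u + length v = length ps"
    show "pair_bracket ((pair_bracket (map fst u), h u) # map fst v) = 0"
    proof (cases "length v = 1")
      case True
      then have "pair_bracket (map fst u) = 0"
        using len False by (simp add: pair_bracket_def)
      then show ?thesis
        using L.parity_homogeneous[OF L.zero_mem] by (simp add: pair_bracket_def)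
    qed (simp add: pair_bracket_def)
  qed
  then show ?thesis by simp
next
  case True
  then obtain f \<xi> d g \<eta> e k \<zeta> c where ps: "ps = [((f, \<xi>), d), ((g, \<eta>), e), ((k, \<zeta>), c)]"
    by (auto simp: length_Suc_conv numeral_3_eq_3)
  have f: "f \<in> GL (d + 1)" and g: "g \<in> GL (e + 1)" and k: "k \<in> GL (c + 1)"
    using hom by (simp_all add: ps homogeneous_pair)
  note par = L.parity_homogeneous[OF f] L.parity_homogeneous[OF g] L.parity_homogeneous[OF k]
    L.parity_homogeneous[OF L.sg_mem[OF L.bracket_degree[OF f g]]]
    L.parity_homogeneous[OF L.sg_mem[OF L.bracket_degree[OF f k]]]
    L.parity_homogeneous[OF L.sg_mem[OF L.bracket_degree[OF g k]]]
    L.parity_homogeneous[OF L.zero_mem]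
  have "brL (brL f g) k = brL f (brL g k) + sg ((e + 1) * (c + 1)) (brL (brL f k) g)"
    by (rule L.br_right[OF f g k])
  moreover have "brL f (brL g k) = - sg ((d + 1) * (e + 1 + (c + 1))) (brL (brL g k) f)"
    by (rule L.br_swap[OF f L.bracket_degree[OF g k]])
  ultimately show ?thesis
    by (simp add: ps pair_bracket_def L.br_sg par)
      (cases "even d"; cases "even e"; cases "even c"; simp add: sg_def)
qed

definition base_operation :: "('l \<times> 'a) list \<Rightarrow> 'l \<times> 'a" where
  "base_operation xs = (pair_bracket xs, P (word xs))"

lemma base_L_infinity:
  assumes two: "(2::'k) \<noteq> 0"
  shows "unshuffle_L_infinity (module_prod.scale sL sA) (sum_grading (suspension GL) GA) base_operation"
proof -
  interpret LA: vector_space_prod sL sA ..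
  have graded: "graded_vector_space LA.scale (sum_grading (suspension GL) GA)"
    by (intro graded_vector_space_prod L.graded_vector_space_suspension A.graded_vector_space_axioms)
  interpret symmetric_brackets LA.scale "sum_grading (suspension GL) GA" base_operation
  proof (intro symmetric_brackets.intro symmetric_brackets_axioms.intro graded)
    show "base_operation [] = 0"
      by (simp add: base_operation_def pair_bracket_def zero_prod_def)
    show "Vector_Spaces.linear LA.scale LA.scale (\<lambda>x. base_operation (xs @ x # ys))" for xs ys
      unfolding Vector_Spaces.linear_iff
      by (auto simp: base_operation_def LA.scale_def word_slot_add word_slot_scale pair_bracket_slot_add
          pair_bracket_slot_scale P.linear.add P.linear.scale LA.p.vector_space_axioms)
    show "base_operation (map fst ps) \<in> sum_grading (suspension GL) GA (deg ps + 1)"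
      if "homogeneous ps" for ps
      using pair_bracket_mem[OF that] P.map_mem[OF word_mem[OF that]]
      by (simp add: base_operation_def homogeneous_pair add.commute)
    show "base_operation (map fst (us @ p # q # vs)) =
        sg (snd p * snd q) (base_operation (map fst (us @ q # p # vs)))"
      if "homogeneous (us @ p # q # vs)" for us p q vs
      unfolding base_operation_def word_swap[OF that] pair_bracket_swap[OF that]
      by (simp add: prod_eq_iff sg_hom[OF P.additive])
  qed
  have "jacobiator ps = 0" if "homogeneous ps" for ps
  proof (rule prod_eqI)
    have add: "additive (fst :: 'l \<times> 'a \<Rightarrow> 'l)" "additive (snd :: 'l \<times> 'a \<Rightarrow> 'a)"
      by (simp_all add: additive_def)
    show "fst (jacobiator ps) = fst 0"
      unfolding jacobiator_def unshuffle_sum_hom[OF add(1), symmetric] base_operation_def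
      using unshuffle_pair_bracket[OF that] by simp
    show "snd (jacobiator ps) = snd 0"
      unfolding jacobiator_def unshuffle_sum_hom[OF add(2), symmetric] base_operation_def
      using unshuffle_P_word[OF two that] by simp
  qed
  then show ?thesis by unfold_locales
qed

section \<open>Insertion of \<open>\<Delta>\<close> and of the scalar\<close>

lemma operations_sL_AD:
  assumes "operations_sL_A sL GL brL sA \<iota>A P \<Delta> lam l"
  shows "l [(f, 0)] = (- brL \<Delta> f, P f)"
    and "l [(0, \<xi>)] = (0, P (act \<Delta> \<xi>))"
    and "f \<in> GL d \<Longrightarrow> l [(f, 0), (g, 0)] = (sL ((- 1) powi d * lam) (brL f g), 0)"
    and "\<xi>s \<noteq> [] \<Longrightarrow> l ((f, 0) # map (Pair 0) \<xi>s) = (0, sA (lam ^ length \<xi>s) (P (acts f \<xi>s)))"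
    and "length \<xi>s \<ge> 2 \<Longrightarrow> l (map (Pair 0) \<xi>s) = (0, sA (lam ^ (length \<xi>s - 1)) (P (acts \<Delta> \<xi>s)))"
    and "length xs \<ge> 3 \<Longrightarrow> i < j \<Longrightarrow> j < length xs \<Longrightarrow> snd (xs ! i) = 0 \<Longrightarrow> snd (xs ! j) = 0 \<Longrightarrow> l xs = 0"
  using assms unfolding operations_sL_A_def by (blast, blast, blast, simp add: Suc_le_eq, blast, blast)

lemma operations_sM_AD:
  assumes "operations_sM_A brL sM GM brM \<iota>M sA \<iota>A P \<Delta> lam l"
  shows "l [(f, 0)] = (- inv \<iota>M (brL \<Delta> (\<iota>M f)), P (\<iota>M f))"
    and "l [(0, \<xi>)] = (0, P (act \<Delta> \<xi>))"
    and "f \<in> GM d \<Longrightarrow> l [(f, 0), (g, 0)] = (sM ((- 1) powi d * lam) (brM f g), 0)"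
    and "\<xi>s \<noteq> [] \<Longrightarrow> l ((f, 0) # map (Pair 0) \<xi>s) = (0, sA (lam ^ length \<xi>s) (P (acts (\<iota>M f) \<xi>s)))"
    and "length \<xi>s \<ge> 2 \<Longrightarrow> l (map (Pair 0) \<xi>s) = (0, sA (lam ^ (length \<xi>s - 1)) (P (acts \<Delta> \<xi>s)))"
    and "length xs \<ge> 3 \<Longrightarrow> i < j \<Longrightarrow> j < length xs \<Longrightarrow> snd (xs ! i) = 0 \<Longrightarrow> snd (xs ! j) = 0 \<Longrightarrow> l xs = 0"
  using assms unfolding operations_sM_A_def by (blast, blast, blast, simp add: Suc_le_eq, blast, blast)

text \<open>Since \<open>\<Delta>\<close> has degree \<open>1\<close> and \<open>P \<Delta> = 0\<close>, the element \<open>s \<Delta>\<close> has degree \<open>0\<close> and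
  satisfies \<open>l\<^sub>1(s \<Delta>) = 0 = l\<^sub>2(s \<Delta>, s \<Delta>)\<close>; inserting it accounts for all terms containing \<open>\<Delta>\<close>.\<close>

definition operation :: "'k \<Rightarrow> ('l \<times> 'a) list \<Rightarrow> 'l \<times> 'a" where
  "operation lam xs = module_prod.scale sL sA (lam ^ (length xs - 1))
     (base_operation xs + base_operation ((\<Delta>, 0) # xs))"

text \<open>In each summand of \<open>word\<close> one entry supplies its \<open>L\<close>-component
  and all others act by their \<open>A\<close>-components; of two entries with
  \<open>A\<close>-component 0 at least one acts.\<close>

lemma word_eq_0:
  assumes "i < j" "j < length xs" "snd (xs ! i) = 0" "snd (xs ! j) = 0"
  shows "word xs = 0"
  using assms
proof (induction xs arbitrary: i j)
  case (Cons x xs)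
  obtain j' where j: "j = Suc j'" using Cons.prems by (cases j) auto
  have "snd (xs ! j') \<in> set (map snd xs)"
    using Cons.prems j by (auto intro!: imageI nth_mem)
  then have acts: "acts (fst x) (map snd xs) = 0"
    using Cons.prems j by (intro acts_eq_0) simp
  show ?case
  proof (cases i)
    case 0
    then show ?thesis
      using acts Cons.prems L.parity_homogeneous[OF L.zero_mem] by (simp add: word.simps(2))
  next
    case (Suc i')
    then have "word xs = 0"
      using Cons.prems j by (intro Cons.IH[of i' j']) simp_all
    then show ?thesis
      using acts by (simp add: word.simps(2))
  qed
qed simp

lemma parity_zero [simp]: "L.parity 0 = 0"
  using L.parity_homogeneous[OF L.zero_mem] by simp

text \<open>The odd degree of \<open>\<Delta>\<close> is the source of the minus sign in
  \<open>l_1(sf)\<close>.\<close>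

lemma parity_Delta: "L.parity \<Delta> = - \<Delta>"
  using L.parity_homogeneous[OF Delta_degree] by (simp add: sg_def)

lemma word_commutative_part: "word (map (Pair 0) \<xi>s) = 0"
  by (induction \<xi>s) (simp_all add: word.simps(2))

lemma word_single: "word ((f, 0) # map (Pair 0) \<xi>s) = acts f \<xi>s"
  by (simp add: word.simps(2) word_commutative_part comp_def)

lemma pair_bracket_eq_0: "length xs \<noteq> 2 \<Longrightarrow> pair_bracket xs = 0"
  by (simp add: pair_bracket_def)

lemma operation_L_infinity:
  assumes two: "(2::'k) \<noteq> 0"
  shows "unshuffle_L_infinity (module_prod.scale sL sA) (sum_grading (suspension GL) GA) (operation lam)"
proof -
  interpret unshuffle_L_infinity "module_prod.scale sL sA" "sum_grading (suspension GL) GA" base_operation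
    using two by (rule base_L_infinity)
  have "(\<Delta>, 0) \<in> sum_grading (suspension GL) GA 0"
    using Delta_degree by (simp add: homogeneous_pair A.zero_mem)
  moreover have "base_operation [(\<Delta>, 0)] = 0"
    using word_single[of \<Delta> "[]"] by (simp add: base_operation_def pair_bracket_eq_0 Delta_kernel zero_prod_def)
  moreover have "base_operation ((\<Delta>, 0) # (\<Delta>, 0) # xs) = 0" for xs
  proof -
    have "pair_bracket ((\<Delta>, 0) # (\<Delta>, 0) # xs) = 0"
      by (simp add: pair_bracket_def parity_Delta L.br_minus Delta_square)
    then show ?thesis
      using word_eq_0[of 0 1 "(\<Delta>, 0) # (\<Delta>, 0) # xs"] by (simp add: base_operation_def zero_prod_def)
  qed
  ultimately interpret t: unshuffle_L_infinity "module_prod.scale sL sA" "sum_grading (suspension GL) GA"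
      "\<lambda>xs. base_operation xs + base_operation ((\<Delta>, 0) # xs)"
    using two by (intro twist)
  \<comment> \<open>Rescaling after twisting counts only the visible arguments: the inserted
    \<open>\<Delta>\<close> adds no factor \<open>lam\<close>, as the exponent \<open>i - 1\<close>
    for \<open>i\<close> arguments from \<open>A\<close> requires.\<close>
  show ?thesis
    unfolding operation_def[abs_def] by (rule t.rescale)
qed

text \<open>An argument \<open>(f, 0)\<close> beside \<open>(\<Delta>, 0)\<close> kills the word by
  \<open>word_eq_0\<close>, so there the twist leaves only \<open>- [\<Delta>, f]\<close>, in arity
  one. On arguments from \<open>A\<close> alone, \<open>\<Delta>\<close> is the only
  \<open>L\<close>-letter and the word is the iterated bracket that starts with it.\<close>

lemma operation_ops: "operations_sL_A sL GL brL sA \<iota>A P \<Delta> lam (operation lam)"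
proof -
  interpret LA: vector_space_prod sL sA ..
  have len2: "word [x, y] = 0" if "snd x = 0" "snd y = 0" for x y
    using word_eq_0[of 0 1 "[x, y]"] that by simp
  show ?thesis
    unfolding operations_sL_A_def
  proof (intro conjI allI impI)
    show "operation lam [(f, 0)] = (- brL \<Delta> f, P f)" for f
      using word_single[of f "[]"]
      by (simp add: operation_def base_operation_def len2 pair_bracket_def parity_Delta L.br_minus LA.scale_def)
    show "operation lam [(0, \<xi>)] = (0, P (act \<Delta> \<xi>))" for \<xi>
      using word_single[of \<Delta> "[\<xi>]"] word_commutative_part[of "[\<xi>]"]
      by (simp add: operation_def base_operation_def pair_bracket_def LA.scale_def)
    show "operation lam [(f, 0), (g, 0)] = (sL ((- 1) powi d * lam) (brL f g), 0)" if "f \<in> GL d" for d f g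
      using word_eq_0[of 0 1 "[(\<Delta>, 0), (f, 0), (g, 0)]"]
      by (simp add: operation_def base_operation_def len2 pair_bracket_def LA.scale_def
          L.parity_homogeneous[OF that] L.br_sg mult.commute L.scale_powi_minus_1 flip: L.scale_scale)
    show "operation lam ((f, 0) # map (Pair 0) \<xi>s) = (0, sA (lam ^ length \<xi>s) (P (acts f \<xi>s)))"
      if "1 \<le> length \<xi>s" for f \<xi>s
    proof -
      have "pair_bracket ((f, 0) # map (Pair 0) \<xi>s) = 0"
        using that by (cases \<xi>s) (simp_all add: pair_bracket_def)
      moreover have "pair_bracket ((\<Delta>, 0) # (f, 0) # map (Pair 0) \<xi>s) = 0"
        using that by (cases \<xi>s) (simp_all add: pair_bracket_def)
      moreover have "word ((\<Delta>, 0) # (f, 0) # map (Pair 0) \<xi>s) = 0"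
        using word_eq_0[of 0 1 "(\<Delta>, 0) # (f, 0) # map (Pair 0) \<xi>s"] by simp
      ultimately show ?thesis
        by (simp add: operation_def base_operation_def word_single LA.scale_def)
    qed
    show "operation lam (map (Pair 0) \<xi>s) = (0, sA (lam ^ (length \<xi>s - 1)) (P (acts \<Delta> \<xi>s)))"
      if "2 \<le> length \<xi>s" for \<xi>s
    proof -
      have "pair_bracket (map (Pair 0) \<xi>s) = 0"
        by (simp add: pair_bracket_def)
      moreover have "pair_bracket ((\<Delta>, 0) # map (Pair 0) \<xi>s) = 0"
        using that by (simp add: pair_bracket_def)
      ultimately show ?thesis
        by (simp add: operation_def base_operation_def word_single word_commutative_part LA.scale_def)
    qed
    show "operation lam xs = 0"
      if "3 \<le> length xs \<and> i < j \<and> j < length xs \<and> snd (xs ! i) = 0 \<and> snd (xs ! j) = 0" for xs i j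
      using that word_eq_0[of i j xs] word_eq_0[of "Suc i" "Suc j" "(\<Delta>, 0) # xs"]
      by (simp add: operation_def base_operation_def pair_bracket_eq_0 LA.scale_def zero_prod_def)
  qed
qed

section \<open>Restriction to \<open>M\<close>\<close>

sublocale \<iota>M: graded_linear_map sM GM sL GL \<iota>M
  using iotaM_hom by unfold_locales (simp add: graded_lie_hom_def)

abbreviation inclusion :: "'m \<times> 'a \<Rightarrow> 'l \<times> 'a" where
  "inclusion \<equiv> \<lambda>(f, \<xi>). (\<iota>M f, \<xi>)"

lemma inj_inclusion: "inj inclusion"
  using iotaM_inj by (auto simp: inj_def)

lemma graded_linear_inclusion:
  "graded_linear (module_prod.scale sM sA) (sum_grading (suspension GM) GA)
     (module_prod.scale sL sA) (sum_grading (suspension GL) GA) inclusion"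
proof -
  interpret LA: vector_space_prod sL sA ..
  interpret MA: vector_space_prod sM sA ..
  show ?thesis
    unfolding graded_linear_def Vector_Spaces.linear_iff
    by (auto simp: MA.p.vector_space_axioms LA.p.vector_space_axioms \<iota>M.linear.add \<iota>M.linear.scale
      MA.scale_def LA.scale_def sum_grading_def suspension_def \<iota>M.map_mem)
qed

text \<open>Only the \<open>L\<close>-component has to be pulled back. It lies in the range of
  \<open>\<iota>M\<close> because \<open>M\<close> is closed under brackets and under
  \<open>[\<Delta>, _]\<close>; outside the range nothing is known of
  \<open>inv \<iota>M\<close>.\<close>

definition restricted_operation :: "'k \<Rightarrow> ('m \<times> 'a) list \<Rightarrow> 'm \<times> 'a" where
  "restricted_operation lam xs =
     apfst (inv \<iota>M) (operation lam (map inclusion xs))"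

lemma inv_iotaM: "inv \<iota>M (\<iota>M f) = f"
  using iotaM_inj by (rule inv_f_f)

lemma Delta_iotaM_range: obtains g where "brL \<Delta> (\<iota>M f) = \<iota>M g"
  using Delta_iotaM by blast

lemma iotaM_bracket: "\<iota>M (brM f g) = brL (\<iota>M f) (\<iota>M g)"
  using iotaM_hom by (simp add: graded_lie_hom_def)

lemma pair_bracket_range: "pair_bracket (map inclusion xs) \<in> range \<iota>M"
proof (cases "length xs = 2")
  case True
  then obtain f \<xi> g \<eta> where "xs = [(f, \<xi>), (g, \<eta>)]"
    by (auto simp: length_Suc_conv numeral_2_eq_2)
  then show ?thesis
    by (simp add: pair_bracket_def \<iota>M.parity_map flip: iotaM_bracket)
next
  case False
  then show ?thesis
    using \<iota>M.linear.zero by (metis length_map pair_bracket_eq_0 rangeI)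
qed

lemma pair_bracket_Delta_range: "pair_bracket ((\<Delta>, 0) # map inclusion xs) \<in> range \<iota>M"
proof (cases "length xs = 1")
  case True
  then obtain f \<xi> where xs: "xs = [(f, \<xi>)]"
    by (auto simp: length_Suc_conv)
  obtain g where "brL \<Delta> (\<iota>M f) = \<iota>M g"
    by (rule Delta_iotaM_range)
  then have "pair_bracket ((\<Delta>, 0) # map inclusion xs) = \<iota>M (- g)"
    by (simp add: xs pair_bracket_def parity_Delta L.br_minus \<iota>M.linear.neg)
  then show ?thesis by simp
next
  case False
  then have "pair_bracket ((\<Delta>, 0) # map inclusion xs) = \<iota>M 0"
    by (simp add: pair_bracket_def)
  then show ?thesis by (metis rangeI)
qed

text \<open>Serves twice: as the hypothesis of \<open>restrict\<close>, and as the compatibility of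
  the inclusion with all operations in (3).\<close>

lemma inclusion_restricted_operation:
  "inclusion (restricted_operation lam xs) = operation lam (map inclusion xs)"
proof -
  interpret LA: vector_space_prod sL sA ..
  obtain f g where "pair_bracket (map inclusion xs) = \<iota>M f"
    "pair_bracket ((\<Delta>, 0) # map inclusion xs) = \<iota>M g"
    using pair_bracket_range pair_bracket_Delta_range by blast
  then have "fst (operation lam (map inclusion xs)) = \<iota>M (sM (lam ^ (length xs - 1)) (f + g))"
    by (simp add: operation_def base_operation_def LA.scale_def \<iota>M.linear.add \<iota>M.linear.scale)
  then show ?thesis
    by (simp add: restricted_operation_def case_prod_beta inv_iotaM prod_eq_iff)
qed

lemma restricted_operation_L_infinity:
  assumes two: "(2::'k) \<noteq> 0"
  shows "unshuffle_L_infinity (module_prod.scale sM sA) (sum_grading (suspension GM) GA)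
    (restricted_operation lam)"
proof -
  interpret unshuffle_L_infinity "module_prod.scale sL sA" "sum_grading (suspension GL) GA" "operation lam"
    using two by (rule operation_L_infinity)
  have graded: "graded_vector_space (module_prod.scale sM sA) (sum_grading (suspension GM) GA)"
    by (intro graded_vector_space_prod M.graded_vector_space_suspension A.graded_vector_space_axioms)
  interpret incl: graded_linear_map "module_prod.scale sM sA" "sum_grading (suspension GM) GA"
      "module_prod.scale sL sA" "sum_grading (suspension GL) GA" inclusion
    using graded graded_vector_space_axioms graded_linear_inclusion
    by (intro graded_linear_map.intro graded_linear_map_axioms.intro)
  show ?thesis
    by (rule restrict[OF graded incl.linear.linear_axioms inj_inclusion
      incl.map_mem_iff[OF inj_inclusion] inclusion_restricted_operation])
qed

lemma restricted_operation_ops: "operations_sM_A brL sM GM brM \<iota>M sA \<iota>A P \<Delta> lam (restricted_operation lam)"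
proof -
  have inv_0: "inv \<iota>M 0 = 0"
    using inv_iotaM[of 0] by simp
  have incl: "map inclusion (map (Pair 0) \<xi>s) = map (Pair 0) \<xi>s" for \<xi>s
    by (induction \<xi>s) auto
  have incl_0: "snd (map inclusion xs ! i) = 0" if "i < length xs" "snd (xs ! i) = 0" for xs i
    using that by (simp add: case_prod_beta)
  note ops = operations_sL_AD[OF operation_ops]
  show ?thesis
    unfolding operations_sM_A_def
  proof (intro conjI allI impI)
    show "restricted_operation lam [(f, 0)] = (- inv \<iota>M (brL \<Delta> (\<iota>M f)), P (\<iota>M f))" for f
    proof -
      obtain g where g: "brL \<Delta> (\<iota>M f) = \<iota>M g"
        by (rule Delta_iotaM_range)
      then show ?thesis
        using inv_iotaM[of "- g"] by (simp add: ops(1) restricted_operation_def inv_iotaM \<iota>M.linear.neg)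
    qed
    show "restricted_operation lam [(0, \<xi>)] = (0, P (act \<Delta> \<xi>))" for \<xi>
      by (simp add: ops(2) restricted_operation_def inv_0)
    show "restricted_operation lam [(f, 0), (g, 0)] = (sM ((- 1) powi d * lam) (brM f g), 0)"
      if "f \<in> GM d" for d f g
    proof -
      have "operation lam [(\<iota>M f, 0), (\<iota>M g, 0)] = (\<iota>M (sM ((- 1) powi d * lam) (brM f g)), 0)"
        by (simp only: ops(3)[OF \<iota>M.map_mem[OF that]] \<iota>M.linear.scale iotaM_bracket)
      then show ?thesis
        by (simp add: restricted_operation_def inv_iotaM)
    qed
    show "restricted_operation lam ((f, 0) # map (Pair 0) \<xi>s) =
        (0, sA (lam ^ length \<xi>s) (P (acts (\<iota>M f) \<xi>s)))" if "1 \<le> length \<xi>s" for f \<xi>s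
      using ops(4)[of \<xi>s] that by (cases "\<xi>s = []") (simp_all add: restricted_operation_def inv_0 incl del: map_map)
    show "restricted_operation lam (map (Pair 0) \<xi>s) =
        (0, sA (lam ^ (length \<xi>s - 1)) (P (acts \<Delta> \<xi>s)))" if "2 \<le> length \<xi>s" for \<xi>s
      using ops(5)[OF that] by (simp add: restricted_operation_def inv_0 incl del: map_map)
    show "restricted_operation lam xs = 0"
      if "3 \<le> length xs \<and> i < j \<and> j < length xs \<and> snd (xs ! i) = 0 \<and> snd (xs ! j) = 0" for xs i j
    proof -
      have "operation lam (map inclusion xs) = 0"
        using that incl_0[of i xs] incl_0[of j xs] by (intro ops(6)[of _ i j]) simp_all
      then show ?thesis
        by (simp add: restricted_operation_def inv_0 zero_prod_def)
    qed
  qed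
qed

section \<open>Uniqueness\<close>

text \<open>The prescribed nonzero components concern entries from a single summand, with an entry
  of \<open>sM\<close> in front of those of \<open>A\<close>. Lists of such entries are sorted by
  how many have \<open>A\<close>-component 0: at least two, exactly one, which symmetry moves to the
  front, or none. Multilinearity then reaches arbitrary lists.\<close>

lemma operations_unique:
  assumes alg: "L_infinity_1_algebra (module_prod.scale sM sA) (sum_grading (suspension GM) GA) l"
      "L_infinity_1_algebra (module_prod.scale sM sA) (sum_grading (suspension GM) GA) l'"
    and ops: "operations_sM_A brL sM GM brM \<iota>M sA \<iota>A P \<Delta> lam l"
      "operations_sM_A brL sM GM brM \<iota>M sA \<iota>A P \<Delta> lam l'"
  shows "l = l'"
proof -
  interpret MA: vector_space_prod sM sA ..
  interpret l: L_infinity_1_algebra MA.scale "sum_grading (suspension GM) GA" l by fact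
  interpret l': L_infinity_1_algebra MA.scale "sum_grading (suspension GM) GA" l' by fact
  note ops = operations_sM_AD[OF ops(1)] operations_sM_AD[OF ops(2)]
  \<comment> \<open>Homogeneity is included because the sign in \<open>l_2\<close> and the symmetry
    axiom refer to degrees.\<close>
  define pure :: "'m \<times> 'a \<Rightarrow> bool" where
    "pure x \<longleftrightarrow> (\<exists>n. fst x \<in> GM n) \<and> snd x = 0 \<or> fst x = 0 \<and> (\<exists>n. snd x \<in> GA n)" for x
  have map_Pair_snd: "xs = map (Pair 0) (map snd xs)" if "\<forall>x\<in>set xs. fst x = 0" for xs :: "('m \<times> 'a) list"
    using that by (induction xs) (auto simp: prod_eq_iff)
  have A_only: "l xs = l' xs" if "\<forall>x\<in>set xs. fst x = 0" for xs
  proof -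
    have xs: "xs = map (Pair 0) (map snd xs)"
      using that by (rule map_Pair_snd)
    consider "xs = []" | "length xs = 1" | "length xs \<ge> 2" by (cases xs) (auto simp: Suc_le_eq)
    then show ?thesis
    proof cases
      case 2
      then obtain \<xi> where "xs = [(0, \<xi>)]" using xs by (auto simp: length_Suc_conv)
      then show ?thesis by (simp only: ops)
    next
      case 3
      then show ?thesis by (subst (1 2) xs) (simp only: ops length_map)
    qed (simp add: l.l_Nil l'.l_Nil)
  qed
  have pure_eq: "l xs = l' xs" if pure: "\<forall>x\<in>set xs. pure x" for xs
  proof (cases "\<exists>i j. i < j \<and> j < length xs \<and> snd (xs ! i) = 0 \<and> snd (xs ! j) = 0")
    case True
    then obtain i j where ij: "i < j" "j < length xs" "snd (xs ! i) = 0" "snd (xs ! j) = 0" by blast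
    show ?thesis
    proof (cases "length xs \<ge> 3")
      case True
      then show ?thesis using ij by (simp only: ops(6,12))
    next
      case False
      then have eq: "i = 0" "j = 1" and "length xs = 2" using ij by auto
      then obtain f g where xs: "xs = [(f, 0), (g, 0)]"
        using ij unfolding eq by (auto simp: length_Suc_conv numeral_2_eq_2)
      \<comment> \<open>The entry \<open>(f, 0)\<close> may be pure through the second alternative;
        then \<open>f = 0\<close>, which has every degree.\<close>
      then obtain d where "f \<in> GM d"
        using pure M.zero_mem by (auto simp: pure_def)
      then show ?thesis by (simp only: xs ops(3,9))
    qed
  next
    case no_two: False
    show ?thesis
    proof (cases "\<exists>x\<in>set xs. snd x = 0")
      case True
      then obtain x where x: "x \<in> set xs" "snd x = 0" by blast
      then obtain us vs where "xs = us @ x # vs" by (auto dest: split_list)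
      note xs = this x(2)
      have "snd y \<noteq> 0" if "y \<in> set us \<union> set vs" for y
      proof
        assume y: "snd y = 0"
        have "(\<exists>i<length us. us ! i = y) \<or> (\<exists>i<length vs. vs ! i = y)"
          using that by (simp add: in_set_conv_nth)
        then consider i where "i < length us" "us ! i = y" | i where "i < length vs" "vs ! i = y"
          by blast
        then show False
        proof cases
          case 1
          then have "i < length us \<and> length us < length xs \<and> snd (xs ! i) = 0 \<and> snd (xs ! length us) = 0"
            using xs y by (simp add: nth_append)
          then show False using no_two by blast
        next
          case 2
          then have "length us < length us + Suc i \<and> length us + Suc i < length xs \<and>
              snd (xs ! length us) = 0 \<and> snd (xs ! (length us + Suc i)) = 0"
            using xs y by (simp add: nth_append)
          then show False using no_two by blast
        qed
      qed
      \<comment> \<open>A pure entry whose \<open>A\<close>-component is nonzero has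
        \<open>M\<close>-component 0.\<close>
      then have rest: "\<forall>y\<in>set (us @ vs). fst y = 0"
        using pure xs by (auto simp: pure_def)
      obtain \<xi>s where \<xi>s: "us @ vs = map (Pair 0) \<xi>s"
        using map_Pair_snd[OF rest] by blast
      obtain f where f: "x = (f, 0)" using xs by (cases x) auto
      let ?ys = "(f, 0) # map (Pair 0) \<xi>s"
      have front: "l ?ys = l' ?ys"
      proof (cases \<xi>s)
        case Nil
        then show ?thesis by (simp only: ops list.map)
      next
        case (Cons \<xi> \<xi>s')
        then have "\<xi>s \<noteq> []" by simp
        then show ?thesis by (simp only: ops(4,10) not_False_eq_True)
      qed
      have mset: "mset xs = mset ?ys"
        by (simp add: xs(1) f flip: \<xi>s)
      then obtain \<sigma> where \<sigma>: "\<sigma> permutes {..<length ?ys}" "permute_list \<sigma> ?ys = xs"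
        by (rule mset_eq_permutation)
      have "\<exists>d. y \<in> sum_grading (suspension GM) GA d" if "y \<in> set ?ys" for y
      proof -
        have "pure y" using pure that mset_eq_setD[OF mset] by blast
        then consider n where "fst y \<in> GM n" "snd y = 0" | n where "fst y = 0" "snd y \<in> GA n"
          unfolding pure_def by blast
        then show ?thesis
        proof cases
          case 1
          then have "y \<in> sum_grading (suspension GM) GA (n - 1)"
            by (simp add: sum_grading_def suspension_def mem_Times_iff A.zero_mem)
          then show ?thesis ..
        next
          case 2
          then have "y \<in> sum_grading (suspension GM) GA n"
            by (simp add: sum_grading_def suspension_def mem_Times_iff M.zero_mem)
          then show ?thesis ..
        qed
      qed
      then obtain d where "\<forall>y\<in>set ?ys. y \<in> sum_grading (suspension GM) GA (d y)" by metis
      then have ds: "list_all2 (\<lambda>x d. x \<in> sum_grading (suspension GM) GA d) ?ys (map d ?ys)"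
        by (simp only: list_all2_map2 list_all2_same)
      show ?thesis
        using l.symmetry[OF ds \<sigma>(1)] l'.symmetry[OF ds \<sigma>(1)] front unfolding \<sigma>(2) by simp
    next
      case False
      then show ?thesis
        using pure by (intro A_only) (auto simp: pure_def)
    qed
  qed
  \<comment> \<open>The pure prefix lets the induction decompose one arbitrary entry of
    \<open>vs\<close> at a time.\<close>
  have "l (us @ vs) = l' (us @ vs)" if "\<forall>x\<in>set us. pure x" for us vs
    using that
  proof (induction vs arbitrary: us)
    case Nil
    then show ?case using pure_eq[of us] by simp
  next
    case (Cons x vs)
    have add: "k (us @ (y + z) # vs) = k (us @ y # vs) + k (us @ z # vs)" if "k \<in> {l, l'}" for k y z
      using that l.multilinear[of us vs] l'.multilinear[of us vs]
      unfolding Vector_Spaces.linear_iff by blast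
    have step: "l (us @ y # vs) = l' (us @ y # vs)" if "pure y" for y
      using Cons.IH[of "us @ [y]"] Cons.prems that by simp
    have additive: "additive (\<lambda>f. k (us @ (f, 0) # vs))" "additive (\<lambda>\<xi>. k (us @ (0, \<xi>) # vs))"
      if "k \<in> {l, l'}" for k
      using add[OF that, of "(_, 0)" "(_, 0)"] add[OF that, of "(0, _)" "(0, _)"]
      by (auto intro!: additive.intro)
    have "l (us @ (fst x, 0) # vs) = l' (us @ (fst x, 0) # vs)"
      by (rule M.additive_eqI[OF additive(1) additive(1)]) (auto intro!: step simp: pure_def)
    moreover have "l (us @ (0, snd x) # vs) = l' (us @ (0, snd x) # vs)"
      by (rule A.additive_eqI[OF additive(2) additive(2)]) (auto intro!: step simp: pure_def)
    moreover have "x = (fst x, 0) + (0, snd x)"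
      by (simp add: prod_eq_iff)
    ultimately show ?case
      using add[of l "(fst x, 0)" "(0, snd x)"] add[of l' "(fst x, 0)" "(0, snd x)"] by simp
  qed
  from this[of "[]"] show ?thesis by auto
qed

text \<open>The case \<open>M = L\<close> with \<open>\<iota>M = id\<close>, through which
  uniqueness on \<open>sL + A\<close> follows from uniqueness on \<open>sM + A\<close>.\<close>

lemma datum_identity: "generalised_V_datum sL GL brL sL GL brL id sA GA brA \<iota>A P \<Delta>"
proof -
  have "Vector_Spaces.linear sL sL id"
    by (rule L.linear_id)
  then have "graded_lie_hom sL GL brL sL GL brL id"
    by (simp add: graded_lie_hom_def graded_linear_def)
  then show ?thesis
    using A_abelian iotaA_hom iotaA_inj P_linear P_iotaA kernel_subalgebra Delta_degree Delta_kernel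
      Delta_square
    by unfold_locales simp_all
qed

lemma operations_sM_A_identity:
  "operations_sM_A brL sL GL brL id sA \<iota>A P \<Delta> lam l \<longleftrightarrow> operations_sL_A sL GL brL sA \<iota>A P \<Delta> lam l"
  by (simp add: operations_sM_A_def operations_sL_A_def)

text \<open>Existence and uniqueness in the form of one rewrite rule, which also replaces the
  quantified algebras of (3) by explicit ones.\<close>

lemma L_infinity_1_algebra_sL_A:
  assumes "(2::'k) \<noteq> 0"
  shows "L_infinity_1_algebra (module_prod.scale sL sA) (sum_grading (suspension GL) GA) l \<and>
    operations_sL_A sL GL brL sA \<iota>A P \<Delta> lam l \<longleftrightarrow> l = operation lam"
proof
  interpret unshuffle_L_infinity "module_prod.scale sL sA" "sum_grading (suspension GL) GA" "operation lam"
    using assms by (rule operation_L_infinity)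
  show "L_infinity_1_algebra (module_prod.scale sL sA) (sum_grading (suspension GL) GA) l \<and>
      operations_sL_A sL GL brL sA \<iota>A P \<Delta> lam l" if "l = operation lam"
    unfolding that by (intro conjI L_infinity_1_algebra_axioms operation_ops)
  show "l = operation lam"
    if "L_infinity_1_algebra (module_prod.scale sL sA) (sum_grading (suspension GL) GA) l \<and>
      operations_sL_A sL GL brL sA \<iota>A P \<Delta> lam l"
    using generalised_V_datum.operations_unique[OF datum_identity] that L_infinity_1_algebra_axioms operation_ops
    unfolding operations_sM_A_identity by blast
qed

lemma L_infinity_1_algebra_sM_A:
  assumes "(2::'k) \<noteq> 0"
  shows "L_infinity_1_algebra (module_prod.scale sM sA) (sum_grading (suspension GM) GA) l \<and>
    operations_sM_A brL sM GM brM \<iota>M sA \<iota>A P \<Delta> lam l \<longleftrightarrow> l = restricted_operation lam"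
proof
  interpret unshuffle_L_infinity "module_prod.scale sM sA" "sum_grading (suspension GM) GA"
      "restricted_operation lam"
    using assms by (rule restricted_operation_L_infinity)
  show "L_infinity_1_algebra (module_prod.scale sM sA) (sum_grading (suspension GM) GA) l \<and>
      operations_sM_A brL sM GM brM \<iota>M sA \<iota>A P \<Delta> lam l" if "l = restricted_operation lam"
    unfolding that by (intro conjI L_infinity_1_algebra_axioms restricted_operation_ops)
  show "l = restricted_operation lam"
    if "L_infinity_1_algebra (module_prod.scale sM sA) (sum_grading (suspension GM) GA) l \<and>
      operations_sM_A brL sM GM brM \<iota>M sA \<iota>A P \<Delta> lam l"
    using operations_unique that L_infinity_1_algebra_axioms restricted_operation_ops by blast
qed

end

theorem theorem4p7:
  fixes sL :: "'k::field_char_0 \<Rightarrow> 'l::ab_group_add \<Rightarrow> 'l" and GL :: "int \<Rightarrow> 'l set"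
    and brL :: "'l \<Rightarrow> 'l \<Rightarrow> 'l"
    and sM :: "'k \<Rightarrow> 'm::ab_group_add \<Rightarrow> 'm" and GM :: "int \<Rightarrow> 'm set"
    and brM :: "'m \<Rightarrow> 'm \<Rightarrow> 'm" and \<iota>M :: "'m \<Rightarrow> 'l"
    and sA :: "'k \<Rightarrow> 'a::ab_group_add \<Rightarrow> 'a" and GA :: "int \<Rightarrow> 'a set"
    and brA :: "'a \<Rightarrow> 'a \<Rightarrow> 'a" and \<iota>A :: "'a \<Rightarrow> 'l"
    and P :: "'l \<Rightarrow> 'a" and \<Delta> :: 'l and lam :: 'k
  assumes "generalised_V_datum sL GL brL sM GM brM \<iota>M sA GA brA \<iota>A P \<Delta>"
  shows
    "(\<exists>!l. L_infinity_1_algebra (module_prod.scale sL sA) (sum_grading (suspension GL) GA) l \<and>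
           operations_sL_A sL GL brL sA \<iota>A P \<Delta> lam l) \<and>
     (\<exists>!l. L_infinity_1_algebra (module_prod.scale sM sA) (sum_grading (suspension GM) GA) l \<and>
           operations_sM_A brL sM GM brM \<iota>M sA \<iota>A P \<Delta> lam l) \<and>
     (\<forall>lL lM.
        L_infinity_1_algebra (module_prod.scale sL sA) (sum_grading (suspension GL) GA) lL \<and>
        operations_sL_A sL GL brL sA \<iota>A P \<Delta> lam lL \<and>
        L_infinity_1_algebra (module_prod.scale sM sA) (sum_grading (suspension GM) GA) lM \<and>
        operations_sM_A brL sM GM brM \<iota>M sA \<iota>A P \<Delta> lam lM \<longrightarrow>
        strict_L_infinity_1_hom
          (module_prod.scale sM sA) (sum_grading (suspension GM) GA) lM
          (module_prod.scale sL sA) (sum_grading (suspension GL) GA) lL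
          (\<lambda>(f, \<xi> :: 'a). (\<iota>M f, \<xi>)) \<and>
        inj (\<lambda>(f, \<xi> :: 'a). (\<iota>M f, \<xi>)))"
proof -
  interpret generalised_V_datum sL GL brL sM GM brM \<iota>M sA GA brA \<iota>A P \<Delta> by fact
  \<comment> \<open>Characteristic 0 enters here, for the two doubling arguments.\<close>
  have two: "(2::'k) \<noteq> 0" by simp
  show ?thesis
    unfolding L_infinity_1_algebra_sL_A[OF two] L_infinity_1_algebra_sM_A[OF two] conj_assoc[symmetric]
    by (auto simp: strict_L_infinity_1_hom_def graded_linear_inclusion inclusion_restricted_operation
      inj_inclusion)
qed

end
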